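(* Let $t_0 \ge 0.2$ and let $G$ solve $$G''(t) = \left(\frac{2}{(t+t_0)^2} - 3Q(t+t_0)^2\right)G(t), \quad t > 0, \qquad G(0) = 0,\ G'(0) = 1.$$ Then $G(t) > 0$ for all $t > 0$. Moreover, there are constants $c > 0$ and $c_2 > 0$ such that $G(t) > c\,t^{c_2}$ for all $t \ge 2.5$.
   Context: $Q(t)$, $t\ge 0$, denotes the radial profile of the positive radial ground state of $\Delta\phi - \phi + |\phi|^2\phi = 0$ on $\mathbb{R}^3$; it solves $-Q'' - \frac{2}{t}Q' + Q - Q^3 = 0$. *)

theory Defs
  imports "HOL-Analysis.Analysis"
begin

text \<open>Radial profile of the positive radial ground state of
  Delta phi - phi + phi^3 = 0 on R^3: positive on [0,inf), continuous on [0,inf),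
  twice differentiable on (0,inf) solving -Q'' - (2/t) Q' + Q - Q^3 = 0,
  regular at the origin (Q'(t) -> 0 as t -> 0+), and decaying at infinity.
  By uniqueness of the ground state (Coffman, Kwong) these properties determine Q.\<close>

definition ground_state_profile :: "(real \<Rightarrow> real) \<Rightarrow> bool" where
  "ground_state_profile Q \<longleftrightarrow>
     (\<forall>t\<ge>0. Q t > 0) \<and> continuous_on {0..} Q \<and>
     (\<exists>Q'. (\<forall>t>0. (Q has_real_derivative Q' t) (at t)) \<and>
           (\<forall>t>0. (Q' has_real_derivative (Q t - Q t ^ 3 - (2 / t) * Q' t)) (at t)) \<and>
           (Q' \<longlongrightarrow> 0) (at_right 0)) \<and>
     (Q \<longlongrightarrow> 0) at_top"

end

theory Submission
  imports Defs
begin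

text \<open>
  Write m = Q^2, y = -Q'/Q, X = r y, R = r^2 and kappa = r^2 (m - 1). Then
  r X' = X^2 - X + kappa and r kappa' = 2 kappa (1 - X) - 2 R X. Along a trajectory, kappa and -R form
  a cooperative system when parametrised by X; hence every solution that is regular at the origin obeys
  kappa \<le> K(X) - C(X) R with explicit polynomials K and C, whatever the value of Q 0.

  This yields a lower bound X > T(r) on [1/5, 1]: otherwise X would stay below T up to r = 1 and the
  profile would enter the region d > k m, where d = 1 + 1/r - y, from which it cannot decay.
  For r \<ge> 1 the profile satisfies 0 < d \<le> k m.

  With u = r Q and v = r Q', the function w = B' u + B v satisfies
  -w'' + (2/r^2 - 3 Q^2) w = (B' (2/r^2 - 3) - B''' - 2 B''/r) u + (-3 B'' + 2 B'/r - B) v,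
  in which Q^2 has cancelled, so that the bounds on y decide whether w is a positive supersolution.
  For r \<ge> 5/2 one takes B = -exp; for smaller r, B is an explicit Laurent polynomial, and a small
  multiple of u is added for r \<ge> 1/2. Sturm comparison with w gives G > 0, and since the Wronskian of
  G and w is increasing while the potential is eventually nonnegative, G grows at least linearly.
\<close>

section \<open>Positivity of integer polynomials on intervals\<close>

text \<open>No numerical value of Q is available. The bounds on y and m must come from the equation,
  regularity at 0 and decay at infinity: regularity bounds kappa from above, and decay then excludes
  those regular solutions for which X is too small. The natural candidate for w is -v = -r Q', which
  is positive and satisfies (-v)'' = (2/r^2 + 1 - 3 Q^2) (-v). The equation for G lacks the mass
  term 1, so -v misses the supersolution inequality by exactly that term, and the weight B has to
  make up for it. The coefficient B' of u is then forced: v' contains -Q^2 u, so -2 B' v'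
  contributes 2 Q^2 B' u, which cancels the -2 Q^2 B' u left over from B' u. The pieces of w are
  joined at 1/2, where the added multiple of u vanishes to fourth order, and at 5/2, where the
  logarithmic derivative of w does not increase. Both transitions preserve the sign of the Wronskian
  with G.\<close>

primrec pval :: "int list \<Rightarrow> real \<Rightarrow> real" where
  "pval [] x = 0"
| "pval (a # p) x = of_int a + x * pval p x"

fun padd :: "int list \<Rightarrow> int list \<Rightarrow> int list" where
  "padd [] q = q"
| "padd p [] = p"
| "padd (a # p) (b # q) = (a + b) # padd p q"

primrec psmult :: "int \<Rightarrow> int list \<Rightarrow> int list" where
  "psmult k [] = []"
| "psmult k (a # p) = (k * a) # psmult k p"

definition psub :: "int list \<Rightarrow> int list \<Rightarrow> int list" where
  "psub p q = padd p (psmult (-1) q)"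

primrec pmul :: "int list \<Rightarrow> int list \<Rightarrow> int list" where
  "pmul [] q = []"
| "pmul (a # p) q = padd (psmult a q) (0 # pmul p q)"

primrec pder :: "int list \<Rightarrow> int list" where
  "pder [] = []"
| "pder (a # p) = padd p (0 # pder p)"

text \<open>Composition with a scaled polynomial, kept integral: the value is D^(length p) p (q /
  D). The exponent is one more than the formal degree, which fixes the powers of 10000 in
  \<open>T_test\<close>.\<close>

primrec phcomp :: "int \<Rightarrow> int list \<Rightarrow> int list \<Rightarrow> int list" where
  "phcomp D [] q = []"
| "phcomp D (a # p) q = padd [a * D ^ (length p + 1)] (pmul q (phcomp D p q))"

primrec pow1 :: "int \<Rightarrow> int list \<Rightarrow> int list" where
  "pow1 d [] = [1]"
| "pow1 d (a # p) = pmul [d, d] (pow1 d p)"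

text \<open>Up to a positive factor, \<open>moebius d a b p\<close> is p ((a + b s) / (d (1 + s))), so that
  nonnegative coefficients give nonnegativity of p on the interval from a / d to b / d.\<close>

primrec moebius :: "int \<Rightarrow> int \<Rightarrow> int \<Rightarrow> int list \<Rightarrow> int list" where
  "moebius d a b [] = []"
| "moebius d a b (c # p) = padd (psmult c (pow1 d p)) (pmul [a, b] (moebius d a b p))"

text \<open>The list holds the numerators, over d, of a subdivision. On each piece the coefficients
  from \<open>moebius\<close> are positive multiples of Bernstein coefficients of p, so a finer
  subdivision certifies smaller margins.\<close>

fun pcheck :: "int \<Rightarrow> int list \<Rightarrow> int list \<Rightarrow> bool" where
  "pcheck d (a # b # bs) p \<longleftrightarrow> list_all (\<lambda>c. 0 \<le> c) (moebius d a b p) \<and> pcheck d (b # bs) p"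
| "pcheck d _ p \<longleftrightarrow> True"

lemma pval_padd [simp]: "pval (padd p q) x = pval p x + pval q x"
  by (induction p q rule: padd.induct) (auto simp: algebra_simps)

lemma pval_psmult [simp]: "pval (psmult k p) x = of_int k * pval p x"
  by (induction p) (auto simp: algebra_simps)

lemma pval_psub [simp]: "pval (psub p q) x = pval p x - pval q x"
  by (simp add: psub_def)

lemma pval_pmul [simp]: "pval (pmul p q) x = pval p x * pval q x"
  by (induction p) (auto simp: algebra_simps)

lemma pval_phcomp [simp]:
  "D \<noteq> 0 \<Longrightarrow> pval (phcomp D p q) x = of_int D ^ length p * pval p (pval q x / of_int D)"
  by (induction p) (auto simp: algebra_simps)

lemma pval_deriv: "(pval p has_real_derivative pval (pder p) x) (at x)"
proof (induction p)
  case (Cons a p)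
  show ?case
    by (auto intro!: derivative_eq_intros Cons simp: algebra_simps)
qed simp

lemma pval_pow1: "pval (pow1 d p) s = (of_int d * (1 + s)) ^ length p"
  by (induction p) (auto simp: algebra_simps)

lemma pval_moebius:
  assumes e: "e = of_int d * (1 + s)" "e \<noteq> 0" and n: "n = of_int a + of_int b * s"
  shows "e * pval (moebius d a b p) s = e ^ length p * pval p (n / e)"
proof (induction p)
  case (Cons c p)
  have pw: "pval (pow1 d p) s = e ^ length p" by (simp add: pval_pow1 e(1))
  have "e * pval (moebius d a b (c # p)) s
      = of_int c * e * e ^ length p + n * (e * pval (moebius d a b p) s)"
    by (simp add: pw n algebra_simps)
  also have "\<dots> = e ^ length (c # p) * pval (c # p) (n / e)"
    unfolding Cons.IH using e(2) by (simp add: algebra_simps)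
  finally show ?case .
qed simp

lemma pval_nonneg_coeffs: "list_all (\<lambda>c. 0 \<le> c) p \<Longrightarrow> 0 \<le> s \<Longrightarrow> 0 \<le> pval p s"
  by (induction p) auto

lemma moebius_nonneg:
  assumes pos: "list_all (\<lambda>c. 0 \<le> c) (moebius d a b p)" and d: "0 < d"
    and x: "of_int a \<le> of_int d * x" "of_int d * x < of_int b"
  shows "0 \<le> pval p x"
proof -
  \<comment> \<open>Inverse of the substitution in \<open>moebius\<close>. The right endpoint
    corresponds to s = infinity and is excluded, which is why later subdivisions overshoot, as with
    51 over 100 for the endpoint 1/2.\<close>
  define s where "s = (of_int d * x - of_int a) / (of_int b - of_int d * x)"
  have s: "0 \<le> s" using x by (simp add: s_def)
  define e where "e = of_int d * (1 + s)"
  have e: "0 < e" using s d by (simp add: e_def)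
  have "(of_int a :: real) + of_int b * s = x * e"
    using x(2) by (simp add: s_def e_def field_simps)
  then have n: "(of_int a + of_int b * s) / e = x" using e by simp
  have "0 \<le> e * pval (moebius d a b p) s"
    using pval_nonneg_coeffs[OF pos s] e by simp
  then have "0 \<le> e ^ length p * pval p x"
    using pval_moebius[OF e_def _ refl, of a b p] n e by simp
  then show ?thesis
    using zero_less_power[OF e, of "length p"] by (auto simp: zero_le_mult_iff)
qed

lemma pcheck_nonneg:
  assumes "pcheck d (a # bs) p" "0 < d" "of_int a \<le> of_int d * x" "of_int d * x < of_int (last (a # bs))"
  shows "0 \<le> pval p x"
  using assms
proof (induction bs arbitrary: a)
  case (Cons b bs)
  show ?case
  proof (cases "of_int d * x < of_int b")
    case True
    with Cons.prems show ?thesis using moebius_nonneg[of d a b p x] by simp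
  next
    case False
    with Cons.prems Cons.IH[of b] show ?thesis by simp
  qed
qed simp

text \<open>Strictness is bought with a margin of 1, small on the integer scale of the polynomials
  tested.\<close>

lemma pcheck_pos:
  assumes "pcheck d (a # bs) (psub p [1])" "0 < d" "of_int a \<le> of_int d * x"
    "of_int d * x < of_int (last (a # bs))"
  shows "0 < pval p x"
  using pcheck_nonneg[OF assms] by simp

section \<open>The barrier polynomials\<close>

text \<open>All coefficients are scaled by 10000. K is fitted from above to the curve kappa(X) of the massless
  limit equation, C from below to its first-order response to R, and TL, TR from below to the solution
  of r T' = T^2 - T + K(T) - C(T) r^2 that is traced backwards from T(1) = 1.7852.\<close>

definition K_poly :: "int list" where "K_poly = [0, 30000, -17720, 55, 1645, -217]"
definition C_poly :: "int list" where "C_poly = [0, 3865, 1626, 320, -430]"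
definition TL_poly :: "int list" where "TL_poly = [262, -4817, 88562, -117147, 53398]"
definition TR_poly :: "int list" where "TR_poly = [-4024, 25806, 5543, -15726, 6253]"

definition KK :: "real \<Rightarrow> real" where "KK x = pval K_poly x / 10000"
definition KK' :: "real \<Rightarrow> real" where "KK' x = pval (pder K_poly) x / 10000"
definition CC :: "real \<Rightarrow> real" where "CC x = pval C_poly x / 10000"
definition CC' :: "real \<Rightarrow> real" where "CC' x = pval (pder C_poly) x / 10000"
definition TL :: "real \<Rightarrow> real" where "TL x = pval TL_poly x / 10000"
definition TL' :: "real \<Rightarrow> real" where "TL' x = pval (pder TL_poly) x / 10000"
definition TR :: "real \<Rightarrow> real" where "TR x = pval TR_poly x / 10000"
definition TR' :: "real \<Rightarrow> real" where "TR' x = pval (pder TR_poly) x / 10000"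

text \<open>With s = log r and R = 0, the derivative of kappa - K(X) at a point where it vanishes is
  2 K (1 - X) - K' (X^2 - X + K). Its sign keeps massless trajectories from rising above the graph
  of K.\<close>

lemma KK_ineq:
  assumes "0 \<le> x" "x < 2"
  shows "2 * KK x * (1 - x) \<le> KK' x * (x\<^sup>2 - x + KK x)"
proof -
  have "0 \<le> pval (psub (pmul (pder K_poly) (padd [0, -10000, 10000] K_poly))
      (pmul [20000, -20000] K_poly)) x"
  proof (rule pcheck_nonneg)
    show "pcheck 2 [0, 1, 2, 3, 4] (psub (pmul (pder K_poly) (padd [0, -10000, 10000] K_poly))
      (pmul [20000, -20000] K_poly))" by code_simp
  qed (use assms in auto)
  then show ?thesis by (simp add: KK_def KK'_def field_simps power2_eq_square)
qed

text \<open>Collects the terms of first order in R in the same computation for kappa = K(X) - C(X)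
  R; see \<open>KC_flow\<close>.\<close>

lemma CC_ineq:
  assumes "0 \<le> x" "x < 2"
  shows "CC x * (2 * x + KK' x) + CC' x * (x\<^sup>2 - x + KK x) \<le> 2 * x"
proof -
  let ?p = "psub [0, 200000000] (padd (pmul C_poly (padd [0, 20000] (pder K_poly)))
      (pmul (pder C_poly) (padd [0, -10000, 10000] K_poly)))"
  have "0 \<le> pval ?p x"
  proof (rule pcheck_nonneg)
    show "pcheck 8 [0, 8, 12, 13, 14, 16] ?p" by code_simp
  qed (use assms in auto)
  then show ?thesis by (simp add: KK_def KK'_def CC_def CC'_def field_simps power2_eq_square)
qed

lemma CC_nonneg:
  assumes "0 \<le> x" "x < 2" shows "0 \<le> CC x"
proof -
  have "0 \<le> pval C_poly x"
  proof (rule pcheck_nonneg)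
    show "pcheck 1 [0, 2] C_poly" by code_simp
  qed (use assms in auto)
  then show ?thesis by (simp add: CC_def)
qed

lemma CC'_bounds:
  assumes "0 \<le> x" "x < 2" shows "0 \<le> CC' x" "CC' x \<le> 1"
proof -
  have "0 \<le> pval (pder C_poly) x"
  proof (rule pcheck_nonneg)
    show "pcheck 1 [0, 2] (pder C_poly)" by code_simp
  qed (use assms in auto)
  then show "0 \<le> CC' x" by (simp add: CC'_def)
  have "0 \<le> pval (psub [10000] (pder C_poly)) x"
  proof (rule pcheck_nonneg)
    show "pcheck 1 [0, 1, 2] (psub [10000] (pder C_poly))" by code_simp
  qed (use assms in auto)
  then show "CC' x \<le> 1" by (simp add: CC'_def)
qed

text \<open>R = 1/4 at r = 1/2, where this yields \<open>m_half\<close>.\<close>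

lemma KC_le:
  assumes "0 \<le> x" "x < 2" shows "KK x - CC x / 4 \<le> 5 / 4"
proof -
  let ?p = "padd (psub [50000] (psmult 4 K_poly)) C_poly"
  have "0 \<le> pval ?p x"
  proof (rule pcheck_nonneg)
    show "pcheck 4 [0, 2, 3, 4, 8] ?p" by code_simp
  qed (use assms in auto)
  then show ?thesis by (simp add: KK_def CC_def)
qed

text \<open>The strict barrier inequality for T = t / 10000, multiplied by 10000^7. Composition with
  the six coefficients of \<open>K_poly\<close> supplies 10000^6 and with the five of
  \<open>C_poly\<close> 10000^5; the entry 10000 in front of C makes up the difference, and the last
  factor is the scaling of K and C themselves.\<close>

definition T_test :: "int list \<Rightarrow> int list" where
  "T_test t = psub (psmult (10000 ^ 6) (padd (pmul [0, 1] (pder t)) t))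
     (padd (psmult (10000 ^ 5) (pmul t t)) (psub (phcomp 10000 K_poly t)
       (pmul [0, 0, 10000] (phcomp 10000 C_poly t))))"

lemma T_test_pos:
  assumes "0 < pval (T_test t) x"
  defines "u \<equiv> pval t x / 10000"
  shows "u\<^sup>2 - u + KK u - CC u * x\<^sup>2 < x * (pval (pder t) x / 10000)"
proof -
  have "pval (T_test t) x = 10000 ^ 7 * (x * (pval (pder t) x / 10000) + u
      - (u\<^sup>2 + (KK u - CC u * x\<^sup>2)))"
    by (simp add: T_test_def KK_def CC_def u_def[symmetric] K_poly_def C_poly_def)
       (simp add: u_def power2_eq_square field_simps)
  with assms(1) show ?thesis by simp
qed

lemma TL_ineq:
  assumes "1 / 5 \<le> x" "x \<le> 1 / 2"
  shows "(TL x)\<^sup>2 - TL x + KK (TL x) - CC (TL x) * x\<^sup>2 < x * TL' x"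
  unfolding TL_def TL'_def
proof (rule T_test_pos, rule pcheck_pos)
  show "pcheck 100 [20, 51] (psub (T_test TL_poly) [1])" by code_simp
qed (use assms in auto)

lemma TR_ineq:
  assumes "1 / 2 \<le> x" "x \<le> 1"
  shows "(TR x)\<^sup>2 - TR x + KK (TR x) - CC (TR x) * x\<^sup>2 < x * TR' x"
  unfolding TR_def TR'_def
proof (rule T_test_pos, rule pcheck_pos)
  show "pcheck 100 [50, 75, 101] (psub (T_test TR_poly) [1])" by code_simp
qed (use assms in auto)

text \<open>Equality holds at x = 0, in accordance with kappa ~ 3 X as r tends to 0. In
  \<open>kappa_le\<close> this keeps the Gronwall rate bounded at the singular point 0.\<close>

lemma KK'_ge:
  assumes "0 \<le> x" "x < 2" shows "3 - 4 * x \<le> KK' x"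
proof -
  have "0 \<le> pval (psub (pder K_poly) [30000, -40000]) x"
  proof (rule pcheck_nonneg)
    show "pcheck 1 [0, 2] (psub (pder K_poly) [30000, -40000])" by code_simp
  qed (use assms in auto)
  then show ?thesis by (simp add: KK'_def)
qed

text \<open>Source of the constant 107/100: at r = 1 one has R = 1 and kappa = m - 1.\<close>

lemma KC_one:
  assumes "17852 / 10000 \<le> x" "x < 2" shows "KK x - CC x \<le> 7 / 100"
proof -
  have "0 \<le> pval (padd [700] (psub C_poly K_poly)) x"
  proof (rule pcheck_nonneg)
    show "pcheck 10000 [17852, 20000] (padd [700] (psub C_poly K_poly))" by code_simp
  qed (use assms in auto)
  then show ?thesis by (simp add: KK_def CC_def)
qed

lemma KK_x1: "KK (17852 / 10000) \<le> 1017 / 1000" and CC_x1: "9535 / 10000 \<le> CC (17852 / 10000)"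
  and TR_1: "TR 1 = 17852 / 10000" and T_join: "TL (1 / 2) \<le> TR (1 / 2)"
  by (simp_all add: KK_def CC_def TR_def TL_def K_poly_def C_poly_def TR_poly_def TL_poly_def)

section \<open>Numerical part of the supersolution inequality\<close>

text \<open>B, B1, N and A are the polynomials r \<beta>, r^2 \<beta>', r^3 (2 \<beta>'/r - 3 \<beta>'' - \<beta>) and
  r^4 (\<beta>''' + 2 \<beta>''/r - \<beta>' (2/r^2 - 3)) for \<beta> = -134/r + 7870 + 3300 r + 3420 r^2 - 890 r^3,
  whose coefficients come from a linear program; D0 = 65 (2 r - 1)^4, with derivatives D1 and D2.\<close>

definition A_poly :: "int list" where "A_poly = [0, 0, -6198, 0, -780, 20520, -8010]"
definition N_poly :: "int list" where "N_poly = [1072, 0, 6734, -14710, 7380, -3420, 890]"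
definition B_poly :: "int list" where "B_poly = [-134, 7870, 3300, 3420, -890]"
definition B1_poly :: "int list" where "B1_poly = [134, 0, 3300, 6840, -2670]"
definition D0_poly :: "int list" where "D0_poly = [65, -520, 1560, -2080, 1040]"
definition D1_poly :: "int list" where "D1_poly = [-520, 3120, -6240, 4160]"
definition D2_poly :: "int list" where "D2_poly = [3120, -12480, 12480]"

text \<open>The supersolution inequality is affine in t = r y, so only the two extreme values
  allowed for t have to be checked.\<close>

lemma affine_between:
  fixes a n x l u :: real
  assumes "0 \<le> a + l * n" "0 \<le> a + u * n" "l \<le> x" "x \<le> u"
  shows "0 \<le> a + x * n"
proof (cases "0 \<le> n")
  case True
  then have "l * n \<le> x * n" using assms by (intro mult_right_mono)
  with assms show ?thesis by linarith
next
  case False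
  then have "u * n \<le> x * n" using assms by (intro mult_right_mono_neg) auto
  with assms show ?thesis by linarith
qed

lemma B_pos:
  assumes "1 / 5 \<le> r" "r \<le> 5 / 2" shows "0 < pval B_poly r"
proof (rule pcheck_pos)
  show "pcheck 100 [20, 251] (psub B_poly [1])" by code_simp
qed (use assms in auto)

lemma left_ineq:
  assumes r: "1 / 5 \<le> r" "r \<le> 1 / 2" and t: "TL r \<le> t" "t \<le> 1 + r"
  shows "0 \<le> pval A_poly r + t * pval N_poly r" "0 < t * pval B_poly r - pval B1_poly r"
proof -
  have "0 < pval (padd (psmult 10000 A_poly) (pmul TL_poly N_poly)) r"
  proof (rule pcheck_pos)
    show "pcheck 100 [20, 51] (psub (padd (psmult 10000 A_poly) (pmul TL_poly N_poly)) [1])"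
      by code_simp
  qed (use r in auto)
  then have 1: "0 \<le> pval A_poly r + TL r * pval N_poly r" by (simp add: TL_def)
  have "0 < pval (padd A_poly (pmul [1, 1] N_poly)) r"
  proof (rule pcheck_pos)
    show "pcheck 100 [20, 51] (psub (padd A_poly (pmul [1, 1] N_poly)) [1])" by code_simp
  qed (use r in auto)
  then have 2: "0 \<le> pval A_poly r + (1 + r) * pval N_poly r" by (simp add: distrib_right)
  show "0 \<le> pval A_poly r + t * pval N_poly r" by (rule affine_between[OF 1 2 t])
  have "0 < pval (psub (pmul TL_poly B_poly) (psmult 10000 B1_poly)) r"
  proof (rule pcheck_pos)
    show "pcheck 100 [20, 51] (psub (psub (pmul TL_poly B_poly) (psmult 10000 B1_poly)) [1])"
      by code_simp
  qed (use r in auto)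
  then have "0 < TL r * pval B_poly r - pval B1_poly r" by (simp add: TL_def)
  moreover have "TL r * pval B_poly r \<le> t * pval B_poly r"
    using B_pos[of r] r t by (intro mult_right_mono) auto
  ultimately show "0 < t * pval B_poly r - pval B1_poly r" by linarith
qed

text \<open>At t = r y this is -r^4 times the \<open>defect\<close> of the supersolution used for r
  \<ge> 1/2, and \<open>W_pos\<close> has the sign of that supersolution. Here m reappears because
  the added \<open>D0_poly\<close> u contributes \<open>D0_poly\<close> (2/r^2 - 1 - 2 m) u; a
  larger m is the worse case.\<close>

definition W_ineq :: "real \<Rightarrow> real \<Rightarrow> real \<Rightarrow> real" where
  "W_ineq r t m = 2 * pval A_poly r + pval D0_poly r * (2 * r\<^sup>2 - r ^ 4 - 2 * m * r ^ 4)
     - pval D2_poly r * r ^ 4 - 2 * pval D1_poly r * r ^ 3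
     + t * (2 * pval N_poly r + 2 * pval D1_poly r * r ^ 3)"

definition W_pos :: "real \<Rightarrow> real \<Rightarrow> real" where
  "W_pos r t = pval D0_poly r * r\<^sup>2 + 2 * (t * pval B_poly r - pval B1_poly r)"

definition base_poly :: "int list" where
  "base_poly = psub (psmult 2 A_poly) (padd (pmul [0, 0, 0, 0, 1] D2_poly) (pmul [0, 0, 0, 2] D1_poly))"
definition slope_poly :: "int list" where
  "slope_poly = padd (psmult 2 N_poly) (pmul [0, 0, 0, 2] D1_poly)"

lemma W_ineq_poly:
  "W_ineq r t m = pval base_poly r + pval D0_poly r * (2 * r\<^sup>2 - r ^ 4 - 2 * m * r ^ 4)
     + t * pval slope_poly r"
  by (simp add: W_ineq_def base_poly_def slope_poly_def power_numeral_reduce algebra_simps)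

lemma D0_nonneg: "0 \<le> pval D0_poly r"
proof -
  have "pval D0_poly r = 65 * (2 * r - 1) ^ 4"
    by (simp add: D0_poly_def power_numeral_reduce algebra_simps)
  then show ?thesis by simp
qed

lemma W_ineq_antimono: "m \<le> m' \<Longrightarrow> W_ineq r t m' \<le> W_ineq r t m"
  unfolding W_ineq_poly using D0_nonneg[of r]
  by (intro add_right_mono add_left_mono mult_left_mono) (auto intro!: mult_right_mono)

lemma W_pos_mono:
  assumes "1 / 5 \<le> r" "r \<le> 5 / 2" "t \<le> t'" shows "W_pos r t \<le> W_pos r t'"
  unfolding W_pos_def using B_pos[OF assms(1,2)] assms(3) by (simp add: mult_right_mono)

lemma mid_ineq:
  assumes r: "1 / 2 \<le> r" "r \<le> 1" and t: "TR r \<le> t" "t \<le> 1 + r" and m: "m \<le> 6"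
  shows "0 \<le> W_ineq r t m" "0 < W_pos r t"
proof -
  let ?a = "padd base_poly (pmul [0, 0, 2, 0, -13] D0_poly)"
  have a: "W_ineq r t 6 = pval ?a r + t * pval slope_poly r" for t
    unfolding W_ineq_poly by (simp add: power_numeral_reduce algebra_simps)
  have "0 < pval (padd (psmult 10000 ?a) (pmul TR_poly slope_poly)) r"
  proof (rule pcheck_pos)
    show "pcheck 100 [50, 101] (psub (padd (psmult 10000 ?a) (pmul TR_poly slope_poly)) [1])"
      by code_simp
  qed (use r in auto)
  then have 1: "0 \<le> pval ?a r + TR r * pval slope_poly r" by (simp add: TR_def)
  have "0 < pval (padd ?a (pmul [1, 1] slope_poly)) r"
  proof (rule pcheck_pos)
    show "pcheck 100 [50, 101] (psub (padd ?a (pmul [1, 1] slope_poly)) [1])" by code_simp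
  qed (use r in auto)
  then have 2: "0 \<le> pval ?a r + (1 + r) * pval slope_poly r" by (simp add: distrib_right)
  have "0 \<le> W_ineq r t 6" unfolding a by (rule affine_between[OF 1 2 t])
  then show "0 \<le> W_ineq r t m" using W_ineq_antimono[OF m, of r t] by linarith
  let ?p = "padd (pmul [0, 0, 10000] D0_poly) (psub (psmult 2 (pmul TR_poly B_poly)) (psmult 20000 B1_poly))"
  have "0 < pval ?p r"
  proof (rule pcheck_pos)
    show "pcheck 100 [50, 101] (psub ?p [1])" by code_simp
  qed (use r in auto)
  then have "0 < W_pos r (TR r)" by (simp add: W_pos_def TR_def power2_eq_square algebra_simps)
  then show "0 < W_pos r t" using W_pos_mono[of r "TR r" t] r t by simp
qed

text \<open>A weight equal to 100 at r = 1 for which M m is nonincreasing on [1, 5/2]; this encodes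
  the decay of m in a polynomial bound.\<close>

definition M_poly :: "int list" where "M_poly = [0, 0, 0, 73, 0, 27]"

lemma right_ineq:
  assumes r: "1 \<le> r" "r \<le> 5 / 2" and d: "0 \<le> d" "100 * (4 * r + 2) * d \<le> (100 * r + 21) * m"
    and m: "pval M_poly r * m \<le> 107"
  shows "0 \<le> W_ineq r (1 + r - r * d) m" "0 < W_pos r (1 + r - r * d)"
proof -
  define M where "M = pval M_poly r"
  \<comment> \<open>\<open>mb\<close> and \<open>db\<close> are the largest values that the
    hypotheses allow for m and d. By monotonicity in m and affinity in t it is enough to test m =
    \<open>mb\<close> at t = 1 + r and at t = 1 + r - r \<open>db\<close>.\<close>
  define mb where "mb = 107 / M"
  define db where "db = (100 * r + 21) * mb / (100 * (4 * r + 2))"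
  have M: "0 < M" using r by (auto simp: M_def M_poly_def intro!: mult_pos_pos add_pos_nonneg)
  have mb: "m \<le> mb" using m M by (simp add: mb_def M_def field_simps)
  have "100 * (4 * r + 2) * d \<le> (100 * r + 21) * mb"
    using d(2) mult_left_mono[OF mb, of "100 * r + 21"] r by linarith
  then have db: "d \<le> db" using r by (simp add: db_def field_simps)
  have e: "100 * (4 * r + 2) * M * (r * db) = 107 * (100 * r + 21) * r"
  proof -
    have "100 * (4 * r + 2) * db = (100 * r + 21) * mb" using r by (simp add: db_def)
    then have "100 * (4 * r + 2) * M * (r * db) = M * mb * (100 * r + 21) * r" by (simp add: mult_ac)
    also have "M * mb = 107" using M by (simp add: mb_def)
    finally show ?thesis .
  qed
  have c: "0 < 100 * (4 * r + 2) * M" using M r by simp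
  let ?a = "padd base_poly (pmul [0, 0, 2, 0, -1] D0_poly)"
  let ?u = "padd ?a (pmul [1, 1] slope_poly)"
  have W: "W_ineq r t mb = pval ?a r - 2 * mb * r ^ 4 * pval D0_poly r + t * pval slope_poly r" for t
    unfolding W_ineq_poly by (simp add: power_numeral_reduce algebra_simps)
  let ?U = "psub (pmul M_poly ?u) (pmul [0, 0, 0, 0, 214] D0_poly)"
  have "0 < pval ?U r"
  proof (rule pcheck_pos)
    show "pcheck 100 [100, 251] (psub ?U [1])" by code_simp
  qed (use r in auto)
  also have "pval ?U r = M * W_ineq r (1 + r) mb"
    unfolding W using M
    by (simp add: M_def[symmetric] mb_def power_numeral_reduce field_simps)
  finally have 1: "0 \<le> W_ineq r (1 + r) mb" using M by (simp add: zero_less_mult_iff)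
  \<comment> \<open>Denominators are cleared by 100 (4 r + 2) M, so that r \<open>db\<close> turns
    into 107 (100 r + 21) r, the list [0, 2247, 10700].\<close>
  let ?L = "psub (pmul (pmul [200, 400] M_poly) ?u)
      (padd (pmul [0, 2247, 10700] slope_poly) (pmul [0, 0, 0, 0, 42800, 85600] D0_poly))"
  have "0 < pval ?L r"
  proof (rule pcheck_pos)
    show "pcheck 200 [200, 351, 426, 502] (psub ?L [1])" by code_simp
  qed (use r in auto)
  also have "pval ?L r = 100 * (4 * r + 2) * M * W_ineq r (1 + r - r * db) mb"
  proof -
    have "100 * (4 * r + 2) * M * W_ineq r (1 + r - r * db) mb
      = 100 * (4 * r + 2) * (M * W_ineq r (1 + r) mb) - 100 * (4 * r + 2) * M * (r * db) * pval slope_poly r"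
      unfolding W by (simp add: algebra_simps)
    also have "M * W_ineq r (1 + r) mb = M * pval ?u r - 214 * r ^ 4 * pval D0_poly r"
      unfolding W using M by (simp add: mb_def field_simps)
    finally show ?thesis unfolding e
      by (simp add: M_def[symmetric] power_numeral_reduce algebra_simps)
  qed
  finally have "0 < W_ineq r (1 + r - r * db) mb" by (rule zero_less_mult_pos[OF _ c])
  then have 2: "0 \<le> W_ineq r (1 + r - r * db) mb" by (rule less_imp_le)
  have t: "1 + r - r * db \<le> 1 + r - r * d" "1 + r - r * d \<le> 1 + r"
    using db d r by (auto intro: mult_left_mono)
  have "0 \<le> W_ineq r (1 + r - r * d) mb"
    using affine_between[OF _ _ t, of "pval ?a r - 2 * mb * r ^ 4 * pval D0_poly r" "pval slope_poly r"]
      1 2 unfolding W by simp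
  then show "0 \<le> W_ineq r (1 + r - r * d) m"
    using W_ineq_antimono[OF mb, of r "1 + r - r * d"] by linarith
  let ?P = "psub (pmul (pmul [200, 400] M_poly) (padd (pmul [0, 0, 1] D0_poly)
      (psub (pmul [2, 2] B_poly) (psmult 2 B1_poly)))) (pmul [0, 4494, 21400] B_poly)"
  have "0 < pval ?P r"
  proof (rule pcheck_pos)
    show "pcheck 100 [100, 251] (psub ?P [1])" by code_simp
  qed (use r in auto)
  also have "pval ?P r = 100 * (4 * r + 2) * M * W_pos r (1 + r - r * db)"
  proof -
    have "100 * (4 * r + 2) * M * W_pos r (1 + r - r * db)
      = 100 * (4 * r + 2) * M * W_pos r (1 + r) - 100 * (4 * r + 2) * M * (r * db) * (2 * pval B_poly r)"
      unfolding W_pos_def by (simp add: algebra_simps)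
    then show ?thesis unfolding e
      by (simp add: W_pos_def M_def[symmetric] power_numeral_reduce algebra_simps)
  qed
  finally have "0 < W_pos r (1 + r - r * db)" by (rule zero_less_mult_pos[OF _ c])
  then show "0 < W_pos r (1 + r - r * d)"
    using W_pos_mono[of r "1 + r - r * db" "1 + r - r * d"] t r by simp
qed

text \<open>This is M' \<le> 2 y M with y replaced by its lower bound from \<open>far_field\<close>,
  multiplied by 10000 r (4 r + 2).\<close>

lemma M_decr:
  assumes r: "1 \<le> r" "r \<le> 5 / 2"
  shows "10000 * r * (4 * r + 2) * pval (pder M_poly) r
    \<le> (20000 * (r + 1) * (4 * r + 2) - 214 * (100 * r + 21)) * pval M_poly r"
proof -
  let ?p = "psub (pmul (psub (pmul [20000, 20000] [2, 4]) [4494, 21400]) M_poly)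
      (pmul (pmul [0, 10000] [2, 4]) (pder M_poly))"
  have "0 \<le> pval ?p r"
  proof (rule pcheck_nonneg)
    show "pcheck 100 [100, 251] ?p" by code_simp
  qed (use r in auto)
  then show ?thesis by (simp add: algebra_simps)
qed

section \<open>Differential inequalities\<close>

lemma last_nonpos:
  fixes f :: "real \<Rightarrow> real"
  assumes ab: "a \<le> b" and cont: "continuous_on {a..b} f" and "f a \<le> 0" "0 < f b"
  obtains z where "a \<le> z" "z < b" "f z = 0" "\<And>t. z < t \<Longrightarrow> t \<le> b \<Longrightarrow> 0 < f t"
proof -
  define S where "S = {t \<in> {a..b}. f t \<le> 0}"
  have "closed S" unfolding S_def
    by (intro continuous_on_closed_Collect_le cont continuous_on_const closed_atLeastAtMost)
  moreover have "bounded S" by (rule bounded_subset[of "{a..b}"]) (auto simp: S_def)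
  ultimately have "compact S" by (simp add: compact_eq_bounded_closed)
  moreover have "a \<in> S" using assms by (simp add: S_def)
  ultimately obtain z where z: "z \<in> S" "\<And>t. t \<in> S \<Longrightarrow> t \<le> z"
    using compact_attains_sup[of S] by blast
  have zb: "a \<le> z" "z < b" using z(1) assms(4) by (auto simp: S_def less_le)
  have pos: "0 < f t" if "z < t" "t \<le> b" for t
    using z(2)[of t] that zb by (force simp: S_def)
  have "0 \<le> f z"
  proof (rule ccontr)
    assume "\<not> 0 \<le> f z"
    moreover have "continuous_on {z..b} f" by (rule continuous_on_subset[OF cont]) (use zb in auto)
    ultimately obtain x where "z \<le> x" "x \<le> b" "f x = 0"
      using IVT'[of f z 0 b] assms(4) zb by force
    with pos[of x] \<open>\<not> 0 \<le> f z\<close> show False by (cases "x = z") auto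
  qed
  moreover have "f z \<le> 0" using z(1) by (simp add: S_def)
  ultimately have "f z = 0" by simp
  then show ?thesis using that zb pos by blast
qed

lemma barrier_nonpos:
  fixes f :: "real \<Rightarrow> real"
  assumes "a \<le> b" "continuous_on {a..b} f" "f a \<le> 0"
    and der: "\<And>t. a \<le> t \<Longrightarrow> t < b \<Longrightarrow> f t = 0 \<Longrightarrow> \<exists>l<0. (f has_real_derivative l) (at t)"
  shows "f b \<le> 0"
proof (rule ccontr)
  assume "\<not> f b \<le> 0"
  then obtain z where z: "a \<le> z" "z < b" "f z = 0" "\<And>t. z < t \<Longrightarrow> t \<le> b \<Longrightarrow> 0 < f t"
    using last_nonpos[OF assms(1-3)] by (metis not_le)
  then obtain l where "l < 0" "(f has_real_derivative l) (at z)" using der by blast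
  then obtain e where e: "0 < e" "\<And>h. 0 < h \<Longrightarrow> h < e \<Longrightarrow> f (z + h) < f z"
    using DERIV_neg_dec_right by blast
  define h where "h = min (e / 2) (b - z)"
  have "f (z + h) < 0" using e z by (auto simp: h_def min_def)
  moreover have "0 < f (z + h)" using e z by (intro z(4)) (auto simp: h_def min_def)
  ultimately show False by simp
qed

text \<open>Derivatives enter only in the open interval, because in \<open>kappa_le\<close> the left
  end is the singular point 0.\<close>

lemma gronwall_nonpos:
  fixes f :: "real \<Rightarrow> real"
  assumes "a \<le> b" "continuous_on {a..b} f" "f a \<le> 0"
    and der: "\<And>t. a < t \<Longrightarrow> t < b \<Longrightarrow> (f has_real_derivative f' t) (at t)"
    and le: "\<And>t. a < t \<Longrightarrow> t < b \<Longrightarrow> 0 < f t \<Longrightarrow> f' t \<le> M * f t"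
  shows "f b \<le> 0"
proof (rule ccontr)
  assume "\<not> f b \<le> 0"
  then obtain z where z: "a \<le> z" "z < b" "f z = 0" "\<And>t. z < t \<Longrightarrow> t \<le> b \<Longrightarrow> 0 < f t"
    using last_nonpos[OF assms(1-3)] by (metis not_le)
  let ?g = "\<lambda>t. exp (- M * t) * f t"
  have "?g z \<ge> ?g b"
  proof (rule DERIV_nonpos_imp_decreasing_open[where f = ?g])
    fix t assume t: "z < t" "t < b"
    have "(?g has_real_derivative exp (- M * t) * (f' t - M * f t)) (at t)"
      using t z by (auto intro!: derivative_eq_intros der simp: algebra_simps)
    moreover have "exp (- M * t) * (f' t - M * f t) \<le> 0"
      using le[of t] z t by (simp add: mult_nonneg_nonpos)
    ultimately show "\<exists>y. (?g has_real_derivative y) (at t) \<and> y \<le> 0" by blast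
  next
    show "continuous_on {z..b} ?g"
      using z by (intro continuous_intros continuous_on_subset[OF assms(2)]) auto
  qed (use z in simp)
  then have "f b \<le> 0" using z(3) by (simp add: mult_le_0_iff)
  with \<open>\<not> f b \<le> 0\<close> show False by simp
qed

lemma first_nonpos:
  fixes f :: "real \<Rightarrow> real"
  assumes ab: "a \<le> b" and cont: "continuous_on {a..b} f" and "0 < f a" "f b \<le> 0"
  obtains z where "a < z" "z \<le> b" "f z = 0" "\<And>t. a \<le> t \<Longrightarrow> t < z \<Longrightarrow> 0 < f t"
proof -
  have "continuous_on {a..b} (\<lambda>t. f (a + b - t))"
    by (rule continuous_on_compose2[OF cont]) (auto intro!: continuous_intros)
  then obtain u where u: "a \<le> u" "u < b" "f (a + b - u) = 0"
      "\<And>t. u < t \<Longrightarrow> t \<le> b \<Longrightarrow> 0 < f (a + b - t)"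
    using last_nonpos[of a b "\<lambda>t. f (a + b - t)"] assms by auto
  show ?thesis
  proof (rule that[of "a + b - u"])
    fix t assume "a \<le> t" "t < a + b - u"
    then show "0 < f t" using u(4)[of "a + b - t"] by simp
  qed (use u in auto)
qed

lemma gronwall_pos:
  fixes f :: "real \<Rightarrow> real"
  assumes ab: "a \<le> b" and cont: "continuous_on {a..b} f" and "0 < f a"
    and der: "\<And>t. a < t \<Longrightarrow> t < b \<Longrightarrow> (f has_real_derivative f' t) (at t)"
    and ge: "\<And>t. a < t \<Longrightarrow> t < b \<Longrightarrow> 0 < f t \<Longrightarrow> - M * f t \<le> f' t"
  shows "0 < f b"
proof (rule ccontr)
  assume "\<not> 0 < f b"
  then obtain z where z: "a < z" "z \<le> b" "f z = 0" and pos: "\<And>t. a \<le> t \<Longrightarrow> t < z \<Longrightarrow> 0 < f t"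
    using first_nonpos[OF ab cont assms(3)] by (metis not_less)
  let ?g = "\<lambda>t. exp (M * t) * f t"
  have "?g a \<le> ?g z"
  proof (rule DERIV_nonneg_imp_increasing_open[where f = ?g])
    fix t assume t: "a < t" "t < z"
    have "(?g has_real_derivative exp (M * t) * (f' t + M * f t)) (at t)"
      using t z by (auto intro!: derivative_eq_intros der simp: algebra_simps)
    moreover have "0 \<le> exp (M * t) * (f' t + M * f t)"
      using ge[of t] pos[of t] z t by simp
    ultimately show "\<exists>y. (?g has_real_derivative y) (at t) \<and> 0 \<le> y" by blast
  next
    show "continuous_on {a..z} ?g"
      using z by (intro continuous_intros continuous_on_subset[OF cont]) auto
  qed (use z in simp)
  then show False using z(3) assms(3) by (simp add: mult_le_0_iff not_le[symmetric])
qed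

section \<open>Profiles of ground states\<close>

locale ground_state =
  fixes Q P :: "real \<Rightarrow> real"
  assumes Q_pos: "0 \<le> t \<Longrightarrow> 0 < Q t"
    and Q_cont: "continuous_on {0..} Q"
    and Q_deriv: "0 < t \<Longrightarrow> (Q has_real_derivative P t) (at t)"
    and P_deriv: "0 < t \<Longrightarrow> (P has_real_derivative (Q t - Q t ^ 3 - (2 / t) * P t)) (at t)"
    and P_lim: "(P \<longlongrightarrow> 0) (at_right 0)"
    and Q_lim: "(Q \<longlongrightarrow> 0) at_top"
begin

section \<open>Energy and strict monotonicity of the profile\<close>

lemma Q_lim0: "(Q \<longlongrightarrow> Q 0) (at_right 0)"
proof -
  have "(Q \<longlongrightarrow> Q 0) (at 0 within {0..})"
    using Q_cont by (simp add: continuous_on_def)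
  then show ?thesis by (rule tendsto_within_subset) auto
qed

text \<open>The energy has derivative -2 P^2 / r, hence decreases. Its eventual sign is read off
  from Q alone: it is at least -Q^2 / 2, which tends to 0.\<close>

lemma energy_nonneg:
  assumes "0 < r" shows "0 \<le> (P r)\<^sup>2 / 2 - (Q r)\<^sup>2 / 2 + Q r ^ 4 / 4"
proof -
  define E where "E = (\<lambda>r. (P r)\<^sup>2 / 2 - (Q r)\<^sup>2 / 2 + Q r ^ 4 / 4)"
  have dE: "(E has_real_derivative - 2 * (P t)\<^sup>2 / t) (at t)" if "0 < t" for t
    unfolding E_def using that
    by (auto intro!: derivative_eq_intros Q_deriv P_deriv
        simp: field_simps power2_eq_square power_numeral_reduce)
  have "- (Q s)\<^sup>2 / 2 \<le> E r" if s: "r \<le> s" for s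
  proof -
    have "- (Q s)\<^sup>2 / 2 \<le> E s" by (simp add: E_def)
    also have "E s \<le> E r"
      using s
    proof (rule DERIV_nonpos_imp_nonincreasing)
      fix t assume "r \<le> t" "t \<le> s"
      then have "0 < t" using assms by simp
      then show "\<exists>y. (E has_real_derivative y) (at t) \<and> y \<le> 0" using dE by fastforce
    qed
    finally show ?thesis .
  qed
  then have "eventually (\<lambda>s. - (Q s)\<^sup>2 / 2 \<le> E r) at_top"
    by (rule eventually_at_top_linorderI)
  moreover have "((\<lambda>s. - (Q s)\<^sup>2 / 2) \<longlongrightarrow> - 0\<^sup>2 / 2) at_top"
    by (intro tendsto_intros Q_lim) simp
  ultimately have "0 \<le> E r" using tendsto_upperbound[of "\<lambda>s. - (Q s)\<^sup>2 / 2"] by fastforce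
  then show ?thesis by (simp add: E_def)
qed

lemma Q0_ge: "2 \<le> (Q 0)\<^sup>2"
proof -
  have "((\<lambda>r. (P r)\<^sup>2 / 2 - (Q r)\<^sup>2 / 2 + Q r ^ 4 / 4) \<longlongrightarrow> 0\<^sup>2 / 2 - (Q 0)\<^sup>2 / 2 + Q 0 ^ 4 / 4) (at_right 0)"
    by (intro tendsto_intros P_lim Q_lim0) auto
  then have "0 \<le> 0\<^sup>2 / 2 - (Q 0)\<^sup>2 / 2 + Q 0 ^ 4 / 4"
    by (rule tendsto_lowerbound)
      (auto intro: eventually_mono[OF eventually_at_right_less] energy_nonneg)
  then have "0 \<le> (Q 0)\<^sup>2 * ((Q 0)\<^sup>2 - 2)" by (simp add: power_numeral_reduce algebra_simps)
  moreover have "0 < (Q 0)\<^sup>2" using Q_pos[of 0] by simp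
  ultimately show ?thesis by (simp add: zero_le_mult_iff)
qed

text \<open>r^2 P starts at 0 and has derivative r^2 Q (1 - Q^2), negative as long as Q > 1.\<close>

lemma P_neg_if_Q_large:
  assumes r: "0 < r" and Q: "\<And>t. 0 < t \<Longrightarrow> t < r \<Longrightarrow> 1 < Q t"
  shows "P r < 0"
proof -
  let ?Z = "\<lambda>t. t\<^sup>2 * P t"
  have "?Z 0 > ?Z r"
  proof (rule DERIV_neg_imp_decreasing_open[OF r, where f = ?Z])
    fix t assume t: "0 < t" "t < r"
    have "(?Z has_real_derivative t\<^sup>2 * (Q t * (1 - (Q t)\<^sup>2))) (at t)"
      using t by (auto intro!: derivative_eq_intros P_deriv
          simp: field_simps power2_eq_square power_numeral_reduce)
    moreover have "t\<^sup>2 * (Q t * (1 - (Q t)\<^sup>2)) < 0"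
      using t Q[OF t] by (auto intro!: mult_pos_neg)
    ultimately show "\<exists>y. (?Z has_real_derivative y) (at t) \<and> y < 0" by blast
  next
    show "continuous_on {0..r} ?Z"
      unfolding continuous_on_eq_continuous_within
    proof
      fix t assume "t \<in> {0..r}"
      show "continuous (at t within {0..r}) ?Z"
      proof (cases "t = 0")
        case True
        have "(?Z \<longlongrightarrow> 0\<^sup>2 * 0) (at_right 0)" by (intro tendsto_intros P_lim)
        then have "(?Z \<longlongrightarrow> ?Z 0) (at 0 within {0..r})"
          using r by (simp add: at_within_Icc_at_right)
        then show ?thesis using True by (simp add: continuous_within)
      next
        case False
        then have "0 < t" using \<open>t \<in> {0..r}\<close> by simp
        then have "isCont ?Z t" by (intro continuous_intros DERIV_isCont[OF P_deriv])
        then show ?thesis by (rule continuous_at_imp_continuous_at_within)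
      qed
    qed
  qed
  then show ?thesis using r by (simp add: mult_less_0_iff)
qed

text \<open>At a first zero z of P the energy forces Q^2 \<ge> 2. Since Q decreases up to z, it
  exceeds 1 on all of (0, z), and the preceding lemma gives P z < 0, a contradiction.\<close>

lemma P_neg:
  assumes r: "0 < r" shows "P r < 0"
proof (rule ccontr)
  assume "\<not> P r < 0"
  have Q0: "1 < Q 0" using Q0_ge Q_pos[of 0] by (smt (verit) one_power2 power_mono)
  have "eventually (\<lambda>t. 1 < Q t) (at_right 0)" using Q_lim0 Q0 by (rule order_tendstoD)
  then obtain e where e: "0 < e" "\<And>t. 0 < t \<Longrightarrow> t < e \<Longrightarrow> 1 < Q t"
    by (auto simp: eventually_at_right_field)
  have neg: "P t < 0" if "0 < t" "t < e" for t
    using that by (intro P_neg_if_Q_large e) auto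
  then have er: "e \<le> r" using \<open>\<not> P r < 0\<close> r by force
  have cont: "continuous_on {a..b} P" if "0 < a" for a b
    using that by (intro DERIV_continuous_on[OF DERIV_subset[OF P_deriv]]) auto
  define S where "S = {t \<in> {e / 2..r}. 0 \<le> P t}"
  have "closed S" unfolding S_def using e
    by (intro continuous_on_closed_Collect_le cont continuous_on_const closed_atLeastAtMost) auto
  moreover have "bounded S" by (rule bounded_subset[of "{e / 2..r}"]) (auto simp: S_def)
  ultimately have "compact S" by (simp add: compact_eq_bounded_closed)
  moreover have "r \<in> S" using \<open>\<not> P r < 0\<close> er e by (simp add: S_def)
  ultimately obtain z where z: "z \<in> S" "\<And>t. t \<in> S \<Longrightarrow> z \<le> t"
    using compact_attains_inf[of S] by blast
  have z0: "0 < z" "e \<le> z" using z(1) e neg by (auto simp: S_def not_less[symmetric])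
  have neg': "P t < 0" if "0 < t" "t < z" for t
  proof (cases "t < e / 2")
    case True then show ?thesis using neg that e by simp
  next
    case False then show ?thesis using z(2)[of t] that z(1) by (fastforce simp: S_def not_le)
  qed
  have "P z \<le> 0"
  proof (rule tendsto_upperbound)
    show "(P \<longlongrightarrow> P z) (at_left z)"
      using DERIV_isCont[OF P_deriv[OF z0(1)]] by (simp add: isCont_def filterlim_at_split)
    show "eventually (\<lambda>t. P t \<le> 0) (at_left z)"
      using z0 neg' by (auto simp: eventually_at_left_field intro!: exI[of _ 0] less_imp_le)
  qed simp
  with z(1) have "P z = 0" by (simp add: S_def)
  with energy_nonneg[OF z0(1)] have "0 \<le> (Q z)\<^sup>2 * ((Q z)\<^sup>2 - 2)"
    by (simp add: power_numeral_reduce algebra_simps)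
  moreover have "0 < (Q z)\<^sup>2" using Q_pos[of z] z0 by simp
  ultimately have "2 \<le> (Q z)\<^sup>2" by (simp add: zero_le_mult_iff)
  then have Qz: "1 < Q z" using Q_pos[of z] z0 by (smt (verit) one_power2 power_mono)
  have "P z < 0"
  proof (rule P_neg_if_Q_large[OF z0(1)])
    fix t assume t: "0 < t" "t < z"
    have "Q t \<ge> Q z"
    proof (rule DERIV_nonpos_imp_decreasing_open[where f = Q])
      show "continuous_on {t..z} Q" using t by (intro continuous_on_subset[OF Q_cont]) auto
    next
      fix x assume "t < x" "x < z"
      then show "\<exists>y. (Q has_real_derivative y) (at x) \<and> y \<le> 0"
        using Q_deriv[of x] neg'[of x] t by (auto intro!: exI[of _ "P x"])
    qed (use t in simp)
    then show "1 < Q t" using Qz by simp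
  qed
  with \<open>P z = 0\<close> show False by simp
qed

section \<open>Riccati variables and their elementary bounds\<close>

definition y :: "real \<Rightarrow> real" where "y r = - P r / Q r"
definition m :: "real \<Rightarrow> real" where "m r = (Q r)\<^sup>2"

lemma m_pos: "0 \<le> r \<Longrightarrow> 0 < m r"
  using Q_pos[of r] by (simp add: m_def)

lemma y_pos: "0 < r \<Longrightarrow> 0 < y r"
  using Q_pos[of r] P_neg[of r] by (simp add: y_def divide_neg_pos)

lemma P_eq: "0 \<le> r \<Longrightarrow> P r = - y r * Q r"
  using Q_pos[of r] by (simp add: y_def)

lemma y_deriv:
  assumes "0 < r" shows "(y has_real_derivative (y r)\<^sup>2 - 2 * y r / r - 1 + m r) (at r)"
  unfolding y_def[abs_def] m_def using assms Q_pos[of r]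
  by (auto intro!: derivative_eq_intros Q_deriv P_deriv
      simp: field_simps power2_eq_square power_numeral_reduce)

lemma m_deriv:
  assumes "0 < r" shows "(m has_real_derivative - 2 * m r * y r) (at r)"
  unfolding y_def[abs_def] m_def[abs_def] using assms Q_pos[of r]
  by (auto intro!: derivative_eq_intros Q_deriv simp: power2_eq_square)

text \<open>The energy inequality divided by Q^2 / 2. It keeps y from falling much below 1 once m is
  small.\<close>

lemma y_energy:
  assumes "0 < r" shows "1 - m r / 2 \<le> (y r)\<^sup>2"
proof -
  have Q: "0 < (Q r)\<^sup>2" using Q_pos[of r] assms by simp
  have "0 \<le> (Q r)\<^sup>2 * ((y r)\<^sup>2 - 1 + m r / 2)"
    using energy_nonneg[OF assms] P_eq[of r] assms
    by (simp add: m_def power_numeral_reduce algebra_simps)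
  with Q show ?thesis by (simp add: zero_le_mult_iff)
qed

lemma m_antimono:
  assumes "0 < r" "r \<le> s" shows "m s \<le> m r"
  using assms(2)
proof (rule DERIV_nonpos_imp_nonincreasing)
  fix x assume x: "r \<le> x" "x \<le> s"
  then have "- 2 * m x * y x \<le> 0" using assms m_pos[of x] y_pos[of x] by simp
  with m_deriv[of x] x assms show "\<exists>y. (m has_real_derivative y) (at x) \<and> y \<le> 0" by auto
qed

lemma m_lim: "(m \<longlongrightarrow> 0) at_top"
proof -
  have "((\<lambda>r. (Q r)\<^sup>2) \<longlongrightarrow> 0\<^sup>2) at_top" by (intro tendsto_intros Q_lim)
  then show ?thesis by (simp add: m_def[abs_def])
qed

lemma y_lim0: "(y \<longlongrightarrow> 0) (at_right 0)"
proof -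
  have "((\<lambda>r. - P r / Q r) \<longlongrightarrow> - 0 / Q 0) (at_right 0)"
    by (intro tendsto_intros P_lim Q_lim0) (use Q_pos[of 0] in auto)
  then show ?thesis by (simp add: y_def[abs_def])
qed

lemma m_lim0: "(m \<longlongrightarrow> m 0) (at_right 0)"
  unfolding m_def[abs_def] by (intro tendsto_intros Q_lim0)

text \<open>If u = r Q satisfied u' + u \<le> 0 somewhere, then u'' \<le> u would drive u below zero.\<close>

lemma y_less:
  assumes r: "0 < r" shows "y r < 1 + 1 / r"
proof (rule ccontr)
  assume "\<not> y r < 1 + 1 / r"
  \<comment> \<open>This is exp (-t) (u' + u) for u = t Q. Since u'' = u - Q^2 u, its derivative is
    -exp (-t) t Q^3.\<close>
  let ?f = "\<lambda>t. exp (- t) * (Q t + t * P t + t * Q t)"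
  have df: "(?f has_real_derivative - (exp (- t) * (t * Q t ^ 3))) (at t)" if "0 < t" for t
    using that by (auto intro!: derivative_eq_intros Q_deriv P_deriv
        simp: field_simps)
  have "?f r \<le> 0"
  proof -
    have "Q r + r * P r + r * Q r = r * Q r * (1 + 1 / r - y r)"
      using P_eq[of r] r by (simp add: field_simps)
    also have "\<dots> \<le> 0" using \<open>\<not> y r < 1 + 1 / r\<close> r Q_pos[of r] by (intro mult_nonneg_nonpos) auto
    finally show ?thesis by (simp add: mult_nonneg_nonpos)
  qed
  define e where "e = - ?f (r + 1)"
  have "?f r > ?f (r + 1)"
  proof (rule DERIV_neg_imp_decreasing[where f = ?f])
    fix x assume "r \<le> x" "x \<le> r + 1"
    then have "0 < x" using r by simp
    then show "\<exists>y. (?f has_real_derivative y) (at x) \<and> y < 0"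
      using df[of x] Q_pos[of x] by (auto intro!: exI[of _ "- (exp (- x) * (x * Q x ^ 3))"])
  qed simp
  then have e: "0 < e" using \<open>?f r \<le> 0\<close> by (simp add: e_def)
  have fe: "?f t \<le> - e" if t: "r + 1 \<le> t" for t
  proof -
    have "?f t \<le> ?f (r + 1)"
      using t
    proof (rule DERIV_nonpos_imp_nonincreasing[where f = ?f])
      fix x assume "r + 1 \<le> x" "x \<le> t"
      then have "0 < x" using r by simp
      then show "\<exists>y. (?f has_real_derivative y) (at x) \<and> y \<le> 0"
        using df[of x] Q_pos[of x] by (auto intro!: exI[of _ "- (exp (- x) * (x * Q x ^ 3))"])
    qed
    then show ?thesis by (simp add: e_def)
  qed
  \<comment> \<open>This is exp t u + e t. The bound on \<open>?f\<close> makes it nonincreasing, so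
    the positive quantity exp t u would lie below a line of slope -e.\<close>
  let ?g = "\<lambda>t. t * Q t * exp t + e * t"
  have g: "?g t \<le> ?g (r + 1)" if t: "r + 1 \<le> t" for t
    using t
  proof (rule DERIV_nonpos_imp_nonincreasing[where f = ?g])
    fix x assume x: "r + 1 \<le> x" "x \<le> t"
    have "(?g has_real_derivative exp x * (Q x + x * P x + x * Q x) + e) (at x)"
      using x r by (auto intro!: derivative_eq_intros Q_deriv simp: algebra_simps)
    moreover have "exp x * (Q x + x * P x + x * Q x) + e \<le> 0"
    proof -
      have "exp x * (Q x + x * P x + x * Q x) = exp (2 * x) * ?f x"
        by (simp add: mult.assoc[symmetric] mult_exp_exp)
      also have "\<dots> \<le> exp (2 * x) * (- e)" using fe[OF x(1)] by (intro mult_left_mono) auto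
      also have "\<dots> \<le> 1 * (- e)" using e x r by (intro mult_right_mono_neg) auto
      finally show ?thesis by simp
    qed
    ultimately show "\<exists>y. (?g has_real_derivative y) (at x) \<and> y \<le> 0" by blast
  qed
  define t where "t = max (r + 1) (?g (r + 1) / e)"
  have "0 < t" using r by (simp add: t_def)
  then have "0 < t * Q t * exp t" using Q_pos[of t] by simp
  moreover have "?g t \<le> ?g (r + 1)" by (rule g) (simp add: t_def)
  moreover have "?g (r + 1) \<le> e * t"
    using e by (simp add: t_def max_def field_simps)
  ultimately show False by linarith
qed

end

section \<open>The barrier for kappa and its effect on X\<close>

lemma KK_deriv: "(KK has_real_derivative KK' x) (at x)"
  unfolding KK_def[abs_def] KK'_def by (intro DERIV_cdivide pval_deriv)

lemma CC_deriv: "(CC has_real_derivative CC' x) (at x)"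
  unfolding CC_def[abs_def] CC'_def by (intro DERIV_cdivide pval_deriv)

lemma TL_deriv: "(TL has_real_derivative TL' x) (at x)"
  unfolding TL_def[abs_def] TL'_def by (intro DERIV_cdivide pval_deriv)

lemma TR_deriv: "(TR has_real_derivative TR' x) (at x)"
  unfolding TR_def[abs_def] TR'_def by (intro DERIV_cdivide pval_deriv)

text \<open>The left side is the derivative of kappa - K(X) + C(X) R in log r on the barrier itself.
  Expanded in R, order 0 is \<open>KK_ineq\<close>, order 1 is \<open>CC_ineq\<close>, and order 2
  has the favourable sign of C C'.\<close>

lemma KC_flow:
  assumes x: "0 \<le> x" "x < 2" and R: "0 \<le> R"
  defines "K \<equiv> KK x - CC x * R"
  shows "2 * K * (1 - x) - 2 * R * x + 2 * CC x * R - (KK' x - CC' x * R) * (x\<^sup>2 - x + K) \<le> 0"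
proof -
  have "0 \<le> (KK' x * (x\<^sup>2 - x + KK x) - 2 * KK x * (1 - x))
      + R * (2 * x - (CC x * (2 * x + KK' x) + CC' x * (x\<^sup>2 - x + KK x))) + R\<^sup>2 * (CC x * CC' x)"
    using KK_ineq[OF x] CC_ineq[OF x] CC_nonneg[OF x] CC'_bounds(1)[OF x] R by (intro add_nonneg_nonneg) auto
  also have "\<dots> = - (2 * K * (1 - x) - 2 * R * x + 2 * CC x * R - (KK' x - CC' x * R) * (x\<^sup>2 - x + K))"
    by (simp add: K_def power2_eq_square algebra_simps)
  finally show ?thesis by simp
qed

context ground_state
begin

lemma X_deriv:
  assumes "0 < r"
  shows "((\<lambda>r. r * y r) has_real_derivative ((r * y r)\<^sup>2 - r * y r + r\<^sup>2 * (m r - 1)) / r) (at r)"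
  using assms by (auto intro!: derivative_eq_intros y_deriv simp: field_simps power2_eq_square)

lemma X_less: "0 < r \<Longrightarrow> r * y r < 1 + r"
  using y_less[of r] by (simp add: field_simps)

lemma X_cont: "0 < a \<Longrightarrow> continuous_on {a..b} (\<lambda>r. r * y r)"
  by (intro DERIV_continuous_on[OF DERIV_subset[OF X_deriv]]) auto

lemma kappa_le:
  assumes b: "0 < b" and X: "\<And>r. 0 < r \<Longrightarrow> r \<le> b \<Longrightarrow> r * y r < 2"
  shows "b\<^sup>2 * (m b - 1) \<le> KK (b * y b) - CC (b * y b) * b\<^sup>2"
proof -
  have "eventually (\<lambda>r. y r < 1) (at_right 0)" using y_lim0 by (rule order_tendstoD) simp
  then obtain e where e: "0 < e" "\<And>r. 0 < r \<Longrightarrow> r < e \<Longrightarrow> y r < 1"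
    by (auto simp: eventually_at_right_field)
  define Y where "Y = max 1 (2 / e)"
  have Y: "y r \<le> Y" if "0 < r" "r \<le> b" for r
  proof (cases "r < e")
    case True then show ?thesis using e(2)[of r] that by (simp add: Y_def)
  next
    case False
    then have "y r < 2 / r" using X[of r] that by (simp add: field_simps)
    also have "2 / r \<le> 2 / e" using False e by (intro divide_left_mono) auto
    finally show ?thesis by (simp add: Y_def)
  qed
  \<comment> \<open>The excess over the barrier, weighted by r so that its derivative contains no
    1/r.\<close>
  define F where "F = (\<lambda>r. r * (r\<^sup>2 * (m r - 1) - KK (r * y r) + CC (r * y r) * r\<^sup>2))"
  define F' where "F' = (\<lambda>r. let x = r * y r; k = r\<^sup>2 * (m r - 1); s = x\<^sup>2 - x + k in
      (k - KK x + CC x * r\<^sup>2) + 2 * k - 2 * x * (k + r\<^sup>2) - KK' x * s + CC' x * s * r\<^sup>2 + 2 * CC x * r\<^sup>2)"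
  have dF: "(F has_real_derivative F' r) (at r)" if "0 < r" for r
  proof -
    have K: "((\<lambda>r. KK (r * y r)) has_real_derivative
        KK' (r * y r) * (((r * y r)\<^sup>2 - r * y r + r\<^sup>2 * (m r - 1)) / r)) (at r)"
      by (rule DERIV_chain2[OF KK_deriv X_deriv[OF that]])
    have C: "((\<lambda>r. CC (r * y r)) has_real_derivative
        CC' (r * y r) * (((r * y r)\<^sup>2 - r * y r + r\<^sup>2 * (m r - 1)) / r)) (at r)"
      by (rule DERIV_chain2[OF CC_deriv X_deriv[OF that]])
    show ?thesis
      unfolding F_def F'_def Let_def using that
      by (auto intro!: derivative_eq_intros K C m_deriv simp: field_simps power2_eq_square)
  qed
  have "F b \<le> 0"
  proof (rule gronwall_nonpos[where f = F and a = 0 and b = b and f' = F' and M = "2 * Y + b"])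
    show "continuous_on {0..b} F"
      unfolding continuous_on_eq_continuous_within
    proof
      fix t assume t: "t \<in> {0..b}"
      show "continuous (at t within {0..b}) F"
      proof (cases "t = 0")
        case True
        have X0: "((\<lambda>r. r * y r) \<longlongrightarrow> 0 * 0) (at_right 0)" by (intro tendsto_intros y_lim0)
        have "isCont KK (0 * 0)" "isCont CC (0 * 0)"
          using KK_deriv CC_deriv by (auto intro: DERIV_isCont)
        then have "((\<lambda>r. KK (r * y r)) \<longlongrightarrow> KK (0 * 0)) (at_right 0)"
          "((\<lambda>r. CC (r * y r)) \<longlongrightarrow> CC (0 * 0)) (at_right 0)"
          using X0 by (auto intro: isCont_tendsto_compose)
        then have "(F \<longlongrightarrow> 0 * (0\<^sup>2 * (m 0 - 1) - KK (0 * 0) + CC (0 * 0) * 0\<^sup>2)) (at_right 0)"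
          unfolding F_def by (intro tendsto_intros m_lim0)
        then have "(F \<longlongrightarrow> F 0) (at 0 within {0..b})"
          using b by (simp add: at_within_Icc_at_right F_def)
        then show ?thesis using True by (simp add: continuous_within)
      next
        case False
        then have "isCont F t" using t by (intro DERIV_isCont[OF dF]) auto
        then show ?thesis by (rule continuous_at_imp_continuous_at_within)
      qed
    qed
  next
    fix r assume r: "0 < r" "r < b" and pos: "0 < F r"
    define x where "x = r * y r"
    define \<Phi> where "\<Phi> = r\<^sup>2 * (m r - 1) - KK x + CC x * r\<^sup>2"
    define K where "K = KK x - CC x * r\<^sup>2"
    have x: "0 \<le> x" "x < 2" using X[of r] y_pos[of r] r by (auto simp: x_def)
    have F: "F r = r * \<Phi>" by (simp add: F_def \<Phi>_def x_def)
    with pos r have \<Phi>: "0 < \<Phi>" by (simp add: zero_less_mult_iff)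
    \<comment> \<open>Writing kappa = K + \<Phi> splits the derivative into its value on the
      barrier, which \<open>KC_flow\<close> controls, and a multiple of the excess \<Phi>.\<close>
    have "F' r = \<Phi> * (3 - 2 * x - KK' x + CC' x * r\<^sup>2)
        + (2 * K * (1 - x) - 2 * r\<^sup>2 * x + 2 * CC x * r\<^sup>2 - (KK' x - CC' x * r\<^sup>2) * (x\<^sup>2 - x + K))"
      unfolding F'_def Let_def x_def[symmetric] by (simp add: \<Phi>_def K_def algebra_simps)
    also have "\<dots> \<le> \<Phi> * (3 - 2 * x - KK' x + CC' x * r\<^sup>2) + 0"
      using KC_flow[OF x, of "r\<^sup>2"] unfolding K_def by (intro add_left_mono) auto
    also have "\<dots> \<le> \<Phi> * (2 * x + r\<^sup>2)"
    proof -
      have "3 - 2 * x - KK' x + CC' x * r\<^sup>2 \<le> 2 * x + r\<^sup>2"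
        using KK'_ge[OF x] mult_right_mono[OF CC'_bounds(2)[OF x], of "r\<^sup>2"] by simp
      then show ?thesis using \<Phi> by simp
    qed
    also have "\<dots> = F r * (2 * y r + r)" by (simp add: F x_def power2_eq_square algebra_simps)
    also have "\<dots> \<le> F r * (2 * Y + b)" using Y[of r] r pos by (intro mult_left_mono) auto
    finally show "F' r \<le> (2 * Y + b) * F r" by (simp add: mult.commute)
  qed (use b dF in \<open>auto simp: F_def\<close>)
  then show ?thesis using b by (simp add: F_def mult_le_0_iff)
qed

lemma X_two: "0 < r \<Longrightarrow> r \<le> 1 \<Longrightarrow> r * y r < 2"
  using X_less[of r] by simp

lemma m_half: "m (1 / 2) \<le> 6"
proof -
  have x: "0 \<le> 1 / 2 * y (1 / 2)" "1 / 2 * y (1 / 2) < 2" using X_two[of "1 / 2"] y_pos[of "1 / 2"] by auto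
  have "(1 / 2)\<^sup>2 * (m (1 / 2) - 1) \<le> KK (1 / 2 * y (1 / 2)) - CC (1 / 2 * y (1 / 2)) * (1 / 2)\<^sup>2"
    by (rule kappa_le) (auto intro: X_two)
  also have "\<dots> \<le> 5 / 4" using KC_le[OF x] by (simp add: power2_eq_square)
  finally show ?thesis by (simp add: power2_eq_square)
qed

text \<open>At a contact X = T the bound on kappa gives r X' < r T', so X cannot overtake T as r
  grows. Used by contradiction: a value of X at or below T would persist up to the right
  end.\<close>

lemma X_le_barrier:
  assumes ab: "0 < a" "a \<le> b" "b \<le> 1" and le: "a * y a \<le> T a"
    and dT: "\<And>r. (T has_real_derivative T' r) (at r)"
    and T: "\<And>r. a \<le> r \<Longrightarrow> r \<le> b \<Longrightarrow> (T r)\<^sup>2 - T r + KK (T r) - CC (T r) * r\<^sup>2 < r * T' r"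
  shows "b * y b \<le> T b"
proof -
  have "b * y b - T b \<le> 0"
  proof (rule barrier_nonpos[where f = "\<lambda>r. r * y r - T r", OF ab(2)])
    show "continuous_on {a..b} (\<lambda>r. r * y r - T r)"
      using ab dT by (intro continuous_intros X_cont DERIV_continuous_on[OF DERIV_subset[OF dT]]) auto
  next
    fix r assume r: "a \<le> r" "r < b" "r * y r - T r = 0"
    have r0: "0 < r" using r ab by simp
    have xT: "r * y r = T r" using r by simp
    have "r\<^sup>2 * (m r - 1) \<le> KK (T r) - CC (T r) * r\<^sup>2"
      using kappa_le[OF r0] X_two xT r ab by fastforce
    then have "(T r)\<^sup>2 - T r + r\<^sup>2 * (m r - 1) < r * T' r" using T[of r] r by simp
    then have "((r * y r)\<^sup>2 - r * y r + r\<^sup>2 * (m r - 1)) / r - T' r < 0"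
      using r0 by (simp add: xT field_simps)
    moreover have "((\<lambda>r. r * y r - T r) has_real_derivative
        ((r * y r)\<^sup>2 - r * y r + r\<^sup>2 * (m r - 1)) / r - T' r) (at r)"
      by (intro DERIV_diff X_deriv dT r0)
    ultimately show "\<exists>l<0. ((\<lambda>r. r * y r - T r) has_real_derivative l) (at r)" by blast
  qed (use le in simp)
  then show ?thesis by simp
qed

lemma y_ge_half:
  assumes "0 < r" "m r \<le> 107 / 100" shows "1 / 2 \<le> y r"
proof -
  have "(1 / 2)\<^sup>2 \<le> (y r)\<^sup>2" using y_energy[OF assms(1)] assms(2) by (simp add: power2_eq_square)
  then show ?thesis by (rule power2_le_imp_le) (use y_pos[OF assms(1)] in simp)
qed

lemma y_ge_m:
  assumes "0 < r" "m r \<le> 2" shows "1 - m r / 2 \<le> y r"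
proof (rule power2_le_imp_le)
  have "(1 - m r / 2)\<^sup>2 \<le> (1 - m r / 2) * 1"
    unfolding power2_eq_square using assms m_pos[of r] by (intro mult_left_mono) auto
  also have "\<dots> \<le> (y r)\<^sup>2" using y_energy[OF assms(1)] by simp
  finally show "(1 - m r / 2)\<^sup>2 \<le> (y r)\<^sup>2" .
qed (use y_pos assms in \<open>auto intro: less_imp_le\<close>)

text \<open>(r m)' = m (1 - 2 r y), and the energy gives y \<ge> 1/2 as soon as m \<le>
  107/100.\<close>

lemma rm_le:
  assumes s: "1 \<le> s" "s * m s \<le> 107 / 100" and r: "s \<le> r"
  shows "r * m r \<le> 107 / 100"
proof -
  have ms: "m s \<le> 107 / 100"
  proof -
    have "1 * m s \<le> s * m s" using s m_pos[of s] by (intro mult_right_mono) auto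
    then show ?thesis using s by simp
  qed
  have "r * m r \<le> s * m s"
  proof (rule DERIV_nonpos_imp_nonincreasing[where f = "\<lambda>r. r * m r", OF r])
    fix x assume x: "s \<le> x" "x \<le> r"
    have "m x \<le> 107 / 100" using m_antimono[of s x] ms x s by simp
    then have "1 / 2 \<le> y x" using x s by (intro y_ge_half) auto
    then have "1 * (1 / 2) \<le> x * y x" using x s by (intro mult_mono) auto
    then have "m x * (1 - 2 * (x * y x)) \<le> 0" using m_pos[of x] x s by (intro mult_nonneg_nonpos) auto
    moreover have "((\<lambda>r. r * m r) has_real_derivative m x * (1 - 2 * (x * y x))) (at x)"
      using x s by (auto intro!: derivative_eq_intros m_deriv simp: algebra_simps)
    ultimately show "\<exists>y. ((\<lambda>r. r * m r) has_real_derivative y) (at x) \<and> y \<le> 0" by blast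
  qed
  then show ?thesis using s by simp
qed

end

section \<open>Consequences of decay: the region r \<ge> 1 and the lower bounds on X\<close>

context ground_state
begin

text \<open>The stable manifold of the decaying solutions lies in the region d \<le> k m: beyond it, the
  distance d - k m grows exponentially, whereas the energy bound forces d to vanish at infinity.\<close>

lemma tail:
  assumes s: "1 \<le> s" "s * m s \<le> 107 / 100"
  shows "100 * (4 * s + 2) * (1 + 1 / s - y s) \<le> (100 * s + 21) * m s"
proof (rule ccontr)
  assume contra: "\<not> ?thesis"
  \<comment> \<open>Since d' = 2 d - d^2 - m and m' is about -2 (1 + 1/r) m, a decaying d is close
    to k m with k (4 + 2/r) = 1, that is k = r / (4 r + 2). The extra 21/100 in the numerator is a
    safety margin.\<close>
  define k where "k = (\<lambda>r :: real. (100 * r + 21) / (100 * (4 * r + 2)))"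
  define \<delta> where "\<delta> = (\<lambda>r. 1 + 1 / r - y r - k r * m r)"
  define \<delta>' where "\<delta>' = (\<lambda>r. - 1 / r\<^sup>2 - ((y r)\<^sup>2 - 2 * y r / r - 1 + m r)
      - 116 / (100 * (4 * r + 2)\<^sup>2) * m r + 2 * k r * m r * y r)"
  have dk: "(k has_real_derivative 116 / (100 * (4 * r + 2)\<^sup>2)) (at r)" if "0 < r" for r
    unfolding k_def using that
    by (auto intro!: derivative_eq_intros simp: power2_eq_square divide_simps) (auto simp: algebra_simps)
  have d\<delta>: "(\<delta> has_real_derivative \<delta>' r) (at r)" if "0 < r" for r
    unfolding \<delta>_def \<delta>'_def using that
    by (auto intro!: derivative_eq_intros dk y_deriv m_deriv simp: power2_eq_square field_simps)
  have m1: "m r \<le> 107 / 100" if "s \<le> r" for r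
  proof -
    have "1 * m r \<le> r * m r" using s that m_pos[of r] by (intro mult_right_mono) auto
    then show ?thesis using rm_le[OF s that] by simp
  qed
  have k: "0 \<le> k r" "4 * k r \<le> 1" if "0 < r" for r
    using that by (auto simp: k_def field_simps)
  have ge: "\<delta> r * (2 - \<delta> r - 4 * k r * m r) \<le> \<delta>' r" if r: "s \<le> r" for r
  proof -
    have r0: "0 < r" using r s by simp
    \<comment> \<open>Where \<delta> vanishes only m B remains of \<delta>', so B \<ge> 0 prevents a
      return from the far side. The margin in k contributes 21 / (100 r), which pays for k' and the
      quadratic term.\<close>
    define B where "B = k r * (4 + 2 / r) - 1 - 116 / (100 * (4 * r + 2)\<^sup>2) - 3 * (k r)\<^sup>2 * m r"
    have y: "y r = 1 + 1 / r - \<delta> r - k r * m r" by (simp add: \<delta>_def)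
    have "\<delta>' r = \<delta> r * (2 - \<delta> r - 4 * k r * m r) + m r * B"
      unfolding \<delta>'_def B_def y using r0 by (simp add: power2_eq_square field_simps)
    moreover have "0 \<le> B"
    proof -
      have k4: "k r * (4 + 2 / r) = 1 + 21 / (100 * r)"
        using r0 by (simp add: k_def divide_simps)
      have mr: "m r \<le> 107 / (100 * r)" using rm_le[OF s r] r0 by (simp add: field_simps)
      have "3 * (k r)\<^sup>2 * m r \<le> 3 * (k r)\<^sup>2 * (107 / (100 * r))" using mr by (intro mult_left_mono) auto
      also have "\<dots> = 321 * (100 * r + 21)\<^sup>2 / (1000000 * r * (4 * r + 2)\<^sup>2)"
        by (simp add: k_def power2_eq_square) (simp add: algebra_simps)
      finally have "B \<ge> 21 / (100 * r) - 116 / (100 * (4 * r + 2)\<^sup>2)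
          - 321 * (100 * r + 21)\<^sup>2 / (1000000 * r * (4 * r + 2)\<^sup>2)"
        unfolding B_def k4 by linarith
      also have "21 / (100 * r) - 116 / (100 * (4 * r + 2)\<^sup>2)
          - 321 * (100 * r + 21)\<^sup>2 / (1000000 * r * (4 * r + 2)\<^sup>2)
        = (210000 * (4 * r + 2)\<^sup>2 - 1160000 * r - 321 * (100 * r + 21)\<^sup>2) / (1000000 * r * (4 * r + 2)\<^sup>2)"
        using r0 by (simp add: divide_simps)
      also have "210000 * (4 * r + 2)\<^sup>2 - 1160000 * r - 321 * (100 * r + 21)\<^sup>2
        = 150000 * r\<^sup>2 + 851800 * r + 698439"
        by (simp add: power2_eq_square algebra_simps)
      finally have "(150000 * r\<^sup>2 + 851800 * r + 698439) / (1000000 * r * (4 * r + 2)\<^sup>2) \<le> B" .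
      moreover have "0 \<le> (150000 * r\<^sup>2 + 851800 * r + 698439) / (1000000 * r * (4 * r + 2)\<^sup>2)"
        using r0 by (intro divide_nonneg_nonneg add_nonneg_nonneg mult_nonneg_nonneg) auto
      ultimately show ?thesis by (rule order_trans[rotated])
    qed
    ultimately show ?thesis using m_pos[of r] r0 by simp
  qed
  have \<delta>le: "\<delta> r \<le> 1 / r + m r / 2" if "s \<le> r" for r
  proof -
    have "0 \<le> k r * m r" using that s k m_pos[of r] by simp
    then show ?thesis using y_ge_m[of r] m1[OF that] that s by (simp add: \<delta>_def)
  qed
  have "0 < \<delta> s"
  proof -
    have "(100 * s + 21) * m s < 100 * (4 * s + 2) * (1 + 1 / s - y s)" using contra by simp
    then have "(100 * s + 21) * m s / (100 * (4 * s + 2)) < 1 + 1 / s - y s"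
      using s by (simp add: pos_divide_less_eq mult.commute)
    then show ?thesis by (simp add: \<delta>_def k_def)
  qed
  have pos: "0 < \<delta> r" if r: "s \<le> r" for r
  proof (rule gronwall_pos[where f = \<delta> and f' = \<delta>' and M = 2, OF r])
    show "continuous_on {s..r} \<delta>"
      using s by (intro DERIV_continuous_on[OF DERIV_subset[OF d\<delta>]]) auto
    show "0 < \<delta> s" by fact
    fix t assume t: "s < t" "t < r"
    show "(\<delta> has_real_derivative \<delta>' t) (at t)" using t s by (intro d\<delta>) auto
    assume "0 < \<delta> t"
    have "0 < t" "1 \<le> t" using t s by auto
    have "\<delta> t \<le> 1 / t + m t / 2" using t by (intro \<delta>le) auto
    also have "\<dots> \<le> 1 + 1" using m1[of t] t \<open>1 \<le> t\<close> by (intro add_mono) auto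
    finally have "\<delta> t \<le> 2" by simp
    moreover have "4 * k t * m t \<le> 1 * m t" using k[of t] m_pos[of t] \<open>0 < t\<close> by (intro mult_right_mono) auto
    ultimately have "- 2 \<le> 2 - \<delta> t - 4 * k t * m t" using m1[of t] t by simp
    then have "\<delta> t * (- 2) \<le> \<delta> t * (2 - \<delta> t - 4 * k t * m t)"
      by (rule mult_left_mono) (use \<open>0 < \<delta> t\<close> in simp)
    then show "- 2 * \<delta> t \<le> \<delta>' t" using ge[of t] t by simp
  qed
  have lim: "((\<lambda>r. 1 / r + m r / 2) \<longlongrightarrow> 0 + 0 / 2) at_top"
    by (intro tendsto_intros m_lim tendsto_divide_0[OF tendsto_const] filterlim_at_top_imp_at_infinity filterlim_ident)
       auto
  have "eventually (\<lambda>r. 1 / r + m r / 2 < 1 / 2) at_top"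
    using order_tendstoD(2)[OF lim, of "1 / 2"] by simp
  moreover have "eventually (\<lambda>r. m r < 1 / 2) at_top"
    using order_tendstoD(2)[OF m_lim, of "1 / 2"] by simp
  ultimately have "eventually (\<lambda>r. s \<le> r \<and> 1 / r + m r / 2 < 1 / 2 \<and> m r < 1 / 2) at_top"
    using eventually_ge_at_top[of s] by eventually_elim simp
  then obtain R where R: "\<And>r. R \<le> r \<Longrightarrow> s \<le> r \<and> 1 / r + m r / 2 < 1 / 2 \<and> m r < 1 / 2"
    by (auto simp: eventually_at_top_linorder)
  have "\<delta> R \<le> 1 / r + m r / 2" if r: "R \<le> r" for r
  proof -
    have "\<delta> R \<le> \<delta> r"
      using r
    proof (rule DERIV_nonneg_imp_nondecreasing[where f = \<delta>])
      fix t assume t: "R \<le> t" "t \<le> r"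
      have st: "s \<le> t" "0 < t" using R[of t] t s by auto
      have "4 * k t * m t \<le> 1 * m t" using k[of t] m_pos[of t] st by (intro mult_right_mono) auto
      then have "0 \<le> 2 - \<delta> t - 4 * k t * m t" using \<delta>le[OF st(1)] R[of t] t by simp
      then have "0 \<le> \<delta> t * (2 - \<delta> t - 4 * k t * m t)" using pos[OF st(1)] by simp
      then have "0 \<le> \<delta>' t" using ge[OF st(1)] by (rule order_trans)
      then show "\<exists>y. (\<delta> has_real_derivative y) (at t) \<and> 0 \<le> y" using d\<delta>[OF st(2)] by blast
    qed
    also have "\<dots> \<le> 1 / r + m r / 2" using R[OF r] by (intro \<delta>le) auto
    finally show ?thesis .
  qed
  then have "eventually (\<lambda>r. \<delta> R \<le> 1 / r + m r / 2) at_top" by (rule eventually_at_top_linorderI)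
  then have "\<delta> R \<le> 0" using tendsto_lowerbound[OF lim] by simp
  with pos[of R] R[of R] show False by simp
qed

text \<open>Otherwise let X grow to exactly 1.7852, at some r \<ge> 1. There the barrier for kappa
  bounds r^2 m, the energy yields r \<le> 2, and the two values violate \<open>tail\<close>.\<close>

lemma X_one: "17852 / 10000 < y 1"
proof (rule ccontr)
  assume "\<not> 17852 / 10000 < y 1"
  define x1 :: real where "x1 = 17852 / 10000"
  have y1: "y 1 \<le> x1" using \<open>\<not> 17852 / 10000 < y 1\<close> by (simp add: x1_def)
  obtain r where r: "1 \<le> r" "r * y r = x1" "\<And>t. 1 \<le> t \<Longrightarrow> t \<le> r \<Longrightarrow> t * y t \<le> x1"
  proof (cases "y 1 = x1")
    case True
    show ?thesis by (rule that[of 1]) (use True in auto)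
  next
    case False
    have "eventually (\<lambda>r. m r < 1) at_top" using order_tendstoD(2)[OF m_lim, of 1] by simp
    then have "eventually (\<lambda>r. 4 \<le> r \<and> m r < 1) at_top"
      using eventually_ge_at_top[of "4::real"] by eventually_elim simp
    then obtain R where R: "4 \<le> R" "m R < 1"
      by (auto simp: eventually_at_top_linorder)
    have "4 * (1 / 2) \<le> R * y R" using R y_ge_half[of R] by (intro mult_mono) auto
    then have 1: "x1 - R * y R \<le> 0" by (simp add: x1_def)
    have 2: "continuous_on {1..R} (\<lambda>r. x1 - r * y r)" by (intro continuous_intros X_cont) simp
    have 3: "0 < x1 - 1 * y 1" using y1 False by simp
    obtain z where "1 < z" "x1 - z * y z = 0" "\<And>t. 1 \<le> t \<Longrightarrow> t < z \<Longrightarrow> 0 < x1 - t * y t"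
      by (rule first_nonpos[OF _ 2 3 1]) (use R in auto)
    then show ?thesis by (intro that[of z]) (auto simp: le_less)
  qed
  have "t * y t < 2" if "0 < t" "t \<le> r" for t
    using X_two[of t] r(3)[of t] that by (cases "t \<le> 1") (auto simp: x1_def)
  then have "r\<^sup>2 * (m r - 1) \<le> KK x1 - CC x1 * r\<^sup>2" using kappa_le[of r] r by auto
  also have "\<dots> \<le> 1017 / 1000 - 9535 / 10000 * r\<^sup>2"
    using KK_x1 CC_x1 unfolding x1_def by (intro diff_mono mult_right_mono) auto
  finally have \<mu>: "r\<^sup>2 * m r \<le> 1017 / 1000 + 465 / 10000 * r\<^sup>2" by (simp add: algebra_simps)
  have r2: "r \<le> 2"
  proof -
    have "r\<^sup>2 * (1 - m r / 2) \<le> r\<^sup>2 * (y r)\<^sup>2" using y_energy[of r] r by (intro mult_left_mono) auto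
    also have "\<dots> = x1\<^sup>2" using r(2) by (simp add: power_mult_distrib[symmetric])
    finally have "r\<^sup>2 \<le> 2\<^sup>2" using \<mu> by (simp add: x1_def power2_eq_square algebra_simps)
    then show ?thesis by (rule power2_le_imp_le) simp
  qed
  \<comment> \<open>On [1, 2] the parabola r^2 lies below its chord 3 r - 2; this turns the bound on
    r^2 m into the hypothesis of \<open>tail\<close>.\<close>
  have "0 \<le> (r - 1) * (2 - r)" using r r2 by simp
  then have r2le: "r\<^sup>2 \<le> 3 * r - 2" by (simp add: power2_eq_square algebra_simps)
  have "r * (r * m r) = r\<^sup>2 * m r" by (simp add: power2_eq_square)
  also have "\<dots> \<le> r * (107 / 100)" using \<mu> r2le r(1) by simp
  finally have "r * (r * m r) \<le> r * (107 / 100)" .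
  then have "r * m r \<le> 107 / 100" using r by simp
  then have "100 * (4 * r + 2) * (1 + 1 / r - y r) \<le> (100 * r + 21) * m r" using r by (intro tail)
  then have "r\<^sup>2 * (100 * (4 * r + 2) * (1 + 1 / r - y r)) \<le> r\<^sup>2 * ((100 * r + 21) * m r)"
    by (intro mult_left_mono) auto
  also have "r\<^sup>2 * (100 * (4 * r + 2) * (1 + 1 / r - y r)) = 100 * (4 * r + 2) * (r\<^sup>2 + r - r * (r * y r))"
    using r by (simp add: power2_eq_square field_simps)
  also have "r\<^sup>2 * ((100 * r + 21) * m r) = (100 * r + 21) * (r\<^sup>2 * m r)" by (simp add: mult_ac)
  also have "\<dots> \<le> (100 * r + 21) * (1017 / 1000 + 465 / 10000 * r\<^sup>2)"
    using \<mu> r by (intro mult_left_mono) auto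
  finally have "100 * (4 * r + 2) * (r\<^sup>2 + r - r * x1)
      \<le> (100 * r + 21) * (1017 / 1000 + 465 / 10000 * r\<^sup>2)" unfolding r(2) .
  moreover define u where "u = r - 1"
  \<comment> \<open>All coefficients in r - 1 are positive. The constant term, the value at r = 1,
    is the margin left by the threshold 1.7852.\<close>
  moreover have "100 * (4 * r + 2) * (r\<^sup>2 + r - r * x1) - (100 * r + 21) * (1017 / 1000 + 465 / 10000 * r\<^sup>2)
    = 39535 / 100 * u ^ 3 + 10709935 / 10000 * u\<^sup>2 + 6971970 / 10000 * u + 1965 / 10000"
    by (simp add: u_def x1_def power_numeral_reduce field_simps)
  moreover have "0 \<le> 39535 / 100 * u ^ 3 + 10709935 / 10000 * u\<^sup>2 + 6971970 / 10000 * u"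
    using r by (intro add_nonneg_nonneg) (auto simp: u_def)
  ultimately show False by linarith
qed

lemma TR_less:
  assumes r: "1 / 2 \<le> r" "r \<le> 1" shows "TR r < r * y r"
proof (rule ccontr)
  assume "\<not> TR r < r * y r"
  have "1 * y 1 \<le> TR 1"
  proof (rule X_le_barrier[of r 1 TR, OF _ _ _ _ TR_deriv])
    show "(TR x)\<^sup>2 - TR x + KK (TR x) - CC (TR x) * x\<^sup>2 < x * TR' x" if "r \<le> x" "x \<le> 1" for x
      using that r by (intro TR_ineq) auto
  qed (use r \<open>\<not> TR r < r * y r\<close> in auto)
  then show False using X_one by (simp add: TR_1)
qed

lemma TL_less:
  assumes r: "1 / 5 \<le> r" "r \<le> 1 / 2" shows "TL r < r * y r"
proof (rule ccontr)
  assume "\<not> TL r < r * y r"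
  have "1 / 2 * y (1 / 2) \<le> TL (1 / 2)"
  proof (rule X_le_barrier[of r "1 / 2" TL, OF _ _ _ _ TL_deriv])
    show "(TL x)\<^sup>2 - TL x + KK (TL x) - CC (TL x) * x\<^sup>2 < x * TL' x" if "r \<le> x" "x \<le> 1 / 2" for x
      using that r by (intro TL_ineq) auto
  qed (use r \<open>\<not> TL r < r * y r\<close> in auto)
  then show False using TR_less[of "1 / 2"] T_join by simp
qed

lemma m_one: "m 1 \<le> 107 / 100"
proof -
  have "1\<^sup>2 * (m 1 - 1) \<le> KK (1 * y 1) - CC (1 * y 1) * 1\<^sup>2"
    by (rule kappa_le) (auto intro: X_two)
  then show ?thesis using KC_one[of "y 1"] X_one X_two[of 1] by simp
qed

lemma far_field:
  assumes "1 \<le> r"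
  shows "r * m r \<le> 107 / 100" "100 * (4 * r + 2) * (1 + 1 / r - y r) \<le> (100 * r + 21) * m r"
proof -
  show "r * m r \<le> 107 / 100" by (rule rm_le[of 1]) (use assms m_one in auto)
  then show "100 * (4 * r + 2) * (1 + 1 / r - y r) \<le> (100 * r + 21) * m r" by (rule tail[OF assms])
qed

lemma y_far:
  assumes "1 \<le> r" shows "1 + 7 / (10 * r) \<le> y r"
proof -
  have "100 * (4 * r + 2) * (1 + 1 / r - y r) \<le> (100 * r + 21) * m r" by (rule far_field[OF assms])
  also have "\<dots> \<le> 100 * (4 * r + 2) / 4 * m r" using assms m_pos[of r] by (intro mult_right_mono) auto
  finally have "1 + 1 / r - y r \<le> m r / 4" using assms by (simp add: divide_simps)
  moreover have "m r / 4 \<le> 3 / (10 * r)" using far_field(1)[OF assms] assms by (simp add: field_simps)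
  moreover have "1 / r - 3 / (10 * r) = 7 / (10 * r)" using assms by (simp add: field_simps)
  ultimately show ?thesis by linarith
qed

lemma m_far:
  assumes r: "1 \<le> r" "r \<le> 5 / 2" shows "pval M_poly r * m r \<le> 107"
proof -
  let ?f = "\<lambda>r. pval M_poly r * m r"
  have "?f r \<le> ?f 1"
  proof (rule DERIV_nonpos_imp_nonincreasing[where f = ?f, OF r(1)])
    fix x assume x: "1 \<le> x" "x \<le> r"
    have x0: "0 < x" "x \<le> 5 / 2" using x r by auto
    define M where "M = pval M_poly x"
    define M' where "M' = pval (pder M_poly) x"
    have M: "0 \<le> M" using x0 by (simp add: M_def M_poly_def)
    define c where "c = 10000 * x * (4 * x + 2)"
    have c: "0 < c" using x0 by (simp add: c_def)
    have "10000 * (4 * x + 2) * (x + 1 - x * y x) = 100 * (4 * x + 2) * (1 + 1 / x - y x) * (100 * x)"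
      using x0 by (simp add: field_simps)
    also have "\<dots> \<le> (100 * x + 21) * m x * (100 * x)"
      using far_field(2)[OF x(1)] x0 by (intro mult_right_mono) auto
    also have "\<dots> = (100 * x + 21) * 100 * (x * m x)" by simp
    also have "\<dots> \<le> (100 * x + 21) * 100 * (107 / 100)"
      using far_field(1)[OF x(1)] x0 by (intro mult_left_mono) auto
    finally have "20000 * (x + 1) * (4 * x + 2) - 214 * (100 * x + 21) \<le> c * (2 * y x)"
      by (simp add: c_def algebra_simps)
    from mult_right_mono[OF this M] M_decr[OF x(1) x0(2)]
    have "c * M' \<le> c * (2 * y x) * M"
      unfolding c_def M_def M'_def by (rule order_trans[rotated])
    then have "M' \<le> 2 * y x * M" using c by (simp add: mult.assoc)
    then have "m x * (M' - 2 * y x * M) \<le> 0" using m_pos[of x] x0 by (intro mult_nonneg_nonpos) auto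
    moreover have "(?f has_real_derivative m x * (M' - 2 * y x * M)) (at x)"
      unfolding M_def M'_def using x0
      by (auto intro!: derivative_eq_intros pval_deriv m_deriv simp: algebra_simps)
    ultimately show "\<exists>y. (?f has_real_derivative y) (at x) \<and> y \<le> 0" by blast
  qed
  also have "?f 1 \<le> 107" using m_one by (simp add: M_poly_def)
  finally show ?thesis .
qed

end

text \<open>While H > 0 the Wronskian has derivative H (V w - w'') \<ge> 0 and stays positive. Then
  H / w increases, so H cannot reach a first zero.\<close>

lemma sturm_comparison:
  fixes H H' w w' w'' V :: "real \<Rightarrow> real"
  assumes "a \<le> b"
    and H: "\<And>t. a \<le> t \<Longrightarrow> t \<le> b \<Longrightarrow> (H has_real_derivative H' t) (at t)"
    and H': "\<And>t. a \<le> t \<Longrightarrow> t \<le> b \<Longrightarrow> (H' has_real_derivative V t * H t) (at t)"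
    and w: "\<And>t. a \<le> t \<Longrightarrow> t \<le> b \<Longrightarrow> (w has_real_derivative w' t) (at t)"
    and w': "\<And>t. a \<le> t \<Longrightarrow> t \<le> b \<Longrightarrow> (w' has_real_derivative w'' t) (at t)"
    and w_pos: "\<And>t. a \<le> t \<Longrightarrow> t \<le> b \<Longrightarrow> 0 < w t"
    and super: "\<And>t. a \<le> t \<Longrightarrow> t \<le> b \<Longrightarrow> w'' t \<le> V t * w t"
    and init: "0 < H a" "0 < H' a * w a - H a * w' a"
  shows "0 < H b" and "H' a * w a - H a * w' a \<le> H' b * w b - H b * w' b"
proof -
  let ?W = "\<lambda>t. H' t * w t - H t * w' t"
  have W_mono: "?W a \<le> ?W s" if s: "a \<le> s" "s \<le> b" and pos: "\<And>t. a \<le> t \<Longrightarrow> t < s \<Longrightarrow> 0 < H t" for s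
  proof (rule DERIV_nonneg_imp_increasing_open[where f = ?W, OF s(1)])
    fix t assume t: "a < t" "t < s"
    have "(?W has_real_derivative H t * (V t * w t - w'' t)) (at t)"
      using t s by (auto intro!: derivative_eq_intros H H' w w' simp: algebra_simps)
    moreover have "0 \<le> H t * (V t * w t - w'' t)" using pos[of t] super[of t] t s by simp
    ultimately show "\<exists>y. (?W has_real_derivative y) (at t) \<and> 0 \<le> y" by blast
  next
    show "continuous_on {a..s} ?W"
      using s by (intro continuous_intros DERIV_continuous_on[OF DERIV_subset[OF H]]
          DERIV_continuous_on[OF DERIV_subset[OF H']] DERIV_continuous_on[OF DERIV_subset[OF w]]
          DERIV_continuous_on[OF DERIV_subset[OF w']]) auto
  qed
  have pos: "0 < H s" if s: "a \<le> s" "s \<le> b" for s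
  proof (rule ccontr)
    assume "\<not> 0 < H s"
    moreover have contH: "continuous_on {a..s} H"
      using s by (intro DERIV_continuous_on[OF DERIV_subset[OF H]]) auto
    ultimately obtain z where z: "a < z" "z \<le> s" "H z = 0" "\<And>t. a \<le> t \<Longrightarrow> t < z \<Longrightarrow> 0 < H t"
      using first_nonpos[OF s(1) contH init(1)] by (metis not_less)
    let ?g = "\<lambda>t. H t / w t"
    have "?g a < ?g z"
    proof (rule DERIV_pos_imp_increasing_open[where f = ?g, OF z(1)])
      fix t assume t: "a < t" "t < z"
      have wt: "0 < w t" using t z s by (intro w_pos) auto
      have "(?g has_real_derivative ?W t / (w t)\<^sup>2) (at t)"
        using t z s wt by (auto intro!: derivative_eq_intros H w simp: power2_eq_square field_simps)
      moreover have "?W a \<le> ?W t" using t z s by (intro W_mono) auto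
      then have "0 < ?W t / (w t)\<^sup>2" using init(2) wt by simp
      ultimately show "\<exists>y. (?g has_real_derivative y) (at t) \<and> 0 < y" by blast
    next
      have "w t \<noteq> 0" if "t \<in> {a..z}" for t using w_pos[of t] that z s by auto
      then show "continuous_on {a..z} ?g"
        using z s by (intro continuous_intros DERIV_continuous_on[OF DERIV_subset[OF H]]
          DERIV_continuous_on[OF DERIV_subset[OF w]]) auto
    qed
    moreover have "0 < ?g a" using init(1) w_pos[of a] assms(1) by simp
    ultimately show False using z(3) by simp
  qed
  show "0 < H b" using pos[of b] assms(1) by simp
  show "?W a \<le> ?W b" using pos assms(1) by (intro W_mono) auto
qed

section \<open>Supersolutions\<close>

definition bet :: "real \<Rightarrow> real" where "bet r = 2 * (- 134 / r + 7870 + 3300 * r + 3420 * r\<^sup>2 - 890 * r ^ 3)"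
definition bet1 :: "real \<Rightarrow> real" where "bet1 r = 2 * (134 / r\<^sup>2 + 3300 + 6840 * r - 2670 * r\<^sup>2)"
definition bet2 :: "real \<Rightarrow> real" where "bet2 r = 2 * (- 268 / r ^ 3 + 6840 - 5340 * r)"
definition bet3 :: "real \<Rightarrow> real" where "bet3 r = 2 * (804 / r ^ 4 - 5340)"

lemma bet_deriv: "0 < r \<Longrightarrow> (bet has_real_derivative bet1 r) (at r)"
  unfolding bet_def[abs_def] bet1_def
  by (auto intro!: derivative_eq_intros simp: power2_eq_square field_simps)

lemma bet1_deriv: "0 < r \<Longrightarrow> (bet1 has_real_derivative bet2 r) (at r)"
  unfolding bet1_def[abs_def] bet2_def
  by (auto intro!: derivative_eq_intros simp: power_numeral_reduce field_simps)

lemma bet2_deriv: "0 < r \<Longrightarrow> (bet2 has_real_derivative bet3 r) (at r)"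
  unfolding bet2_def[abs_def] bet3_def
  by (auto intro!: derivative_eq_intros simp: power_numeral_reduce field_simps)

text \<open>With B = -\<open>bet\<close>, the combination \<open>alp\<close> u - \<open>bet\<close>
  v equals B' u + B v + \<delta> \<open>D0_poly\<close> u. Only \<delta> = 0, up to r = 1/2, and
  \<delta> = 1, from there on, occur.\<close>

definition alp :: "real \<Rightarrow> real \<Rightarrow> real" where "alp \<delta> r = \<delta> * pval D0_poly r - bet1 r"
definition alp1 :: "real \<Rightarrow> real \<Rightarrow> real" where "alp1 \<delta> r = \<delta> * pval D1_poly r - bet2 r"
definition alp2 :: "real \<Rightarrow> real \<Rightarrow> real" where "alp2 \<delta> r = \<delta> * pval D2_poly r - bet3 r"

lemma alp_deriv: "0 < r \<Longrightarrow> (alp \<delta> has_real_derivative alp1 \<delta> r) (at r)"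
proof -
  have "pval (pder D0_poly) r = pval D1_poly r" by (simp add: D0_poly_def D1_poly_def)
  then show "0 < r \<Longrightarrow> ?thesis"
    unfolding alp_def[abs_def] alp1_def using pval_deriv[of D0_poly r]
    by (auto intro!: derivative_eq_intros bet1_deriv)
qed

lemma alp1_deriv: "0 < r \<Longrightarrow> (alp1 \<delta> has_real_derivative alp2 \<delta> r) (at r)"
proof -
  have "pval (pder D1_poly) r = pval D2_poly r" by (simp add: D1_poly_def D2_poly_def)
  then show "0 < r \<Longrightarrow> ?thesis"
    unfolding alp1_def[abs_def] alp2_def using pval_deriv[of D1_poly r]
    by (auto intro!: derivative_eq_intros bet2_deriv)
qed

lemma alp_half: "alp 1 (1 / 2) = alp 0 (1 / 2)" "alp1 1 (1 / 2) = alp1 0 (1 / 2)"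
  by (simp_all add: alp_def alp1_def D0_poly_def D1_poly_def)

lemma W_pos_eq: "0 < r \<Longrightarrow> W_pos r (r * y) = r\<^sup>2 * (alp 1 r + bet r * y)"
  by (simp add: W_pos_def alp_def bet_def bet1_def B_poly_def B1_poly_def power_numeral_reduce field_simps)

lemma left_pos_eq:
  "0 < r \<Longrightarrow> 2 * (r * y * pval B_poly r - pval B1_poly r) = r\<^sup>2 * (alp 0 r + bet r * y)"
  by (simp add: alp_def bet_def bet1_def B_poly_def B1_poly_def power_numeral_reduce field_simps)

text \<open>For w = a u - b v one has w'' = (2/r^2 - 3 m) w + r Q * defect.\<close>

definition defect :: "(real \<Rightarrow> real) \<Rightarrow> (real \<Rightarrow> real) \<Rightarrow> (real \<Rightarrow> real) \<Rightarrow> (real \<Rightarrow> real) \<Rightarrow>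
    (real \<Rightarrow> real) \<Rightarrow> (real \<Rightarrow> real) \<Rightarrow> real \<Rightarrow> real \<Rightarrow> real \<Rightarrow> real" where
  "defect a a1 a2 b b1 b2 r y m = a2 r + 2 * a1 r / r + a r * (1 - 2 / r\<^sup>2) + 2 * m * (a r + b1 r) - 2 * b1 r
     - y * (2 * a1 r - b2 r + 2 * b1 r / r - b r)"

lemma W_ineq_eq:
  "0 < r \<Longrightarrow> W_ineq r (r * y) m = - (r ^ 4 * defect (alp 1) (alp1 1) (alp2 1) bet bet1 bet2 r y m)"
  by (simp add: W_ineq_def defect_def alp_def alp1_def alp2_def bet_def bet1_def bet2_def bet3_def
      A_poly_def N_poly_def power_numeral_reduce field_simps)

lemma left_ineq_eq:
  "0 < r \<Longrightarrow> 2 * (pval A_poly r + r * y * pval N_poly r)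
    = - (r ^ 4 * defect (alp 0) (alp1 0) (alp2 0) bet bet1 bet2 r y m)"
  by (simp add: defect_def alp_def alp1_def alp2_def bet_def bet1_def bet2_def bet3_def
      A_poly_def N_poly_def power_numeral_reduce field_simps)

section \<open>Positivity and supersolution property of the combinations of u and v\<close>

context ground_state
begin

definition comb :: "(real \<Rightarrow> real) \<Rightarrow> (real \<Rightarrow> real) \<Rightarrow> real \<Rightarrow> real" where
  "comb a b r = a r * (r * Q r) - b r * (r * P r)"

definition comb1 :: "(real \<Rightarrow> real) \<Rightarrow> (real \<Rightarrow> real) \<Rightarrow> (real \<Rightarrow> real) \<Rightarrow> (real \<Rightarrow> real) \<Rightarrow> real \<Rightarrow> real" where
  "comb1 a a1 b b1 r = a1 r * (r * Q r) + a r * (Q r + r * P r) - b1 r * (r * P r)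
     - b r * (r * Q r - r * Q r ^ 3 - P r)"

lemma comb_eq: "0 < r \<Longrightarrow> comb a b r = r * Q r * (a r + b r * y r)"
  using P_eq[of r] by (simp add: comb_def algebra_simps)

lemma comb1_eq:
  "0 < r \<Longrightarrow> comb1 a a1 b b1 r = r * Q r * (a1 r + a r * (1 / r - y r) + b1 r * y r - b r * (1 - m r) - b r * y r / r)"
  using P_eq[of r] by (simp add: comb1_def m_def power_numeral_reduce field_simps)

lemma comb_deriv:
  assumes r: "0 < r" and a: "(a has_real_derivative a1 r) (at r)" and b: "(b has_real_derivative b1 r) (at r)"
  shows "(comb a b has_real_derivative comb1 a a1 b b1 r) (at r)"
  unfolding comb_def[abs_def] comb1_def using r
  by (auto intro!: derivative_eq_intros a b Q_deriv P_deriv simp: field_simps)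

lemma comb1_deriv:
  assumes r: "0 < r" and a: "(a has_real_derivative a1 r) (at r)" "(a1 has_real_derivative a2 r) (at r)"
    and b: "(b has_real_derivative b1 r) (at r)" "(b1 has_real_derivative b2 r) (at r)"
  shows "(comb1 a a1 b b1 has_real_derivative
    (2 / r\<^sup>2 - 3 * m r) * comb a b r + r * Q r * defect a a1 a2 b b1 b2 r (y r) (m r)) (at r)"
proof -
  have "(comb1 a a1 b b1 has_real_derivative
      a2 r * (r * Q r) + a1 r * (Q r + r * P r)
      + (a1 r * (Q r + r * P r) + a r * (P r + (P r + r * (Q r - Q r ^ 3 - (2 / r) * P r))))
      - (b2 r * (r * P r) + b1 r * (P r + r * (Q r - Q r ^ 3 - (2 / r) * P r)))
      - (b1 r * (r * Q r - r * Q r ^ 3 - P r) + b r * ((Q r + r * P r) - (Q r ^ 3 + r * (3 * (Q r)\<^sup>2 * P r))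
          - (Q r - Q r ^ 3 - (2 / r) * P r)))) (at r)"
    unfolding comb1_def[abs_def] using r
    by (auto intro!: derivative_eq_intros a b Q_deriv P_deriv simp: algebra_simps)
  moreover have "a2 r * (r * Q r) + a1 r * (Q r + r * P r)
      + (a1 r * (Q r + r * P r) + a r * (P r + (P r + r * (Q r - Q r ^ 3 - (2 / r) * P r))))
      - (b2 r * (r * P r) + b1 r * (P r + r * (Q r - Q r ^ 3 - (2 / r) * P r)))
      - (b1 r * (r * Q r - r * Q r ^ 3 - P r) + b r * ((Q r + r * P r) - (Q r ^ 3 + r * (3 * (Q r)\<^sup>2 * P r))
          - (Q r - Q r ^ 3 - (2 / r) * P r)))
    = (2 / r\<^sup>2 - 3 * m r) * comb a b r + r * Q r * defect a a1 a2 b b1 b2 r (y r) (m r)"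
    unfolding comb_def defect_def m_def using r P_eq[of r]
    by (simp add: power_numeral_reduce field_simps)
  ultimately show ?thesis by simp
qed

definition w_far :: "real \<Rightarrow> real" where "w_far = comb (\<lambda>r. - exp r) exp"
definition w_far' :: "real \<Rightarrow> real" where "w_far' = comb1 (\<lambda>r. - exp r) (\<lambda>r. - exp r) exp exp"
definition w_near :: "real \<Rightarrow> real \<Rightarrow> real" where "w_near \<delta> = comb (alp \<delta>) bet"
definition w_near' :: "real \<Rightarrow> real \<Rightarrow> real" where "w_near' \<delta> = comb1 (alp \<delta>) (alp1 \<delta>) bet bet1"

lemma w_near_deriv:
  assumes "0 < r"
  shows "(w_near \<delta> has_real_derivative w_near' \<delta> r) (at r)"
    and "(w_near' \<delta> has_real_derivative (2 / r\<^sup>2 - 3 * m r) * w_near \<delta> r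
      + r * Q r * defect (alp \<delta>) (alp1 \<delta>) (alp2 \<delta>) bet bet1 bet2 r (y r) (m r)) (at r)"
  unfolding w_near_def w_near'_def
  using assms by (auto intro!: comb_deriv comb1_deriv alp_deriv alp1_deriv bet_deriv bet1_deriv)

text \<open>For B = -exp the defect is a multiple of d = 1 + 1/r - y, so \<open>y_less\<close> alone
  decides its sign.\<close>

lemma w_far_deriv:
  assumes "0 < r"
  shows "(w_far has_real_derivative w_far' r) (at r)"
    and "(w_far' has_real_derivative (2 / r\<^sup>2 - 3 * m r) * w_far r
      + r * Q r * (- exp r * (4 - 2 / r) * (1 + 1 / r - y r))) (at r)"
proof -
  show "(w_far has_real_derivative w_far' r) (at r)"
    unfolding w_far_def w_far'_def
    using assms by (intro comb_deriv) (auto intro!: derivative_eq_intros)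
  have "(w_far' has_real_derivative (2 / r\<^sup>2 - 3 * m r) * w_far r + r * Q r *
      defect (\<lambda>r. - exp r) (\<lambda>r. - exp r) (\<lambda>r. - exp r) exp exp exp r (y r) (m r)) (at r)"
    unfolding w_far_def w_far'_def
    using assms by (intro comb1_deriv) (auto intro!: derivative_eq_intros)
  moreover have "defect (\<lambda>r. - exp r) (\<lambda>r. - exp r) (\<lambda>r. - exp r) exp exp exp r (y r) (m r)
      = - exp r * (4 - 2 / r) * (1 + 1 / r - y r)"
    using assms by (simp add: defect_def power2_eq_square field_simps)
  ultimately show "(w_far' has_real_derivative (2 / r\<^sup>2 - 3 * m r) * w_far r
      + r * Q r * (- exp r * (4 - 2 / r) * (1 + 1 / r - y r))) (at r)" by simp
qed

lemma near_left:
  assumes r: "1 / 5 \<le> r" "r \<le> 1 / 2"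
  shows "0 < w_near 0 r" "defect (alp 0) (alp1 0) (alp2 0) bet bet1 bet2 r (y r) (m r) \<le> 0"
proof -
  have r0: "0 < r" using r by simp
  note left = left_ineq[OF r less_imp_le[OF TL_less[OF r]] less_imp_le[OF X_less[OF r0]]]
  have "0 < r\<^sup>2 * (alp 0 r + bet r * y r)" using left(2) left_pos_eq[OF r0, of "y r"] by simp
  then have "0 < alp 0 r + bet r * y r" using r0 by (simp add: zero_less_mult_iff)
  then show "0 < w_near 0 r" using r0 Q_pos[of r] by (simp add: w_near_def comb_eq)
  show "defect (alp 0) (alp1 0) (alp2 0) bet bet1 bet2 r (y r) (m r) \<le> 0"
  proof -
    have "0 \<le> 2 * (pval A_poly r + r * y r * pval N_poly r)" using left(1) by simp
    then have "r ^ 4 * defect (alp 0) (alp1 0) (alp2 0) bet bet1 bet2 r (y r) (m r) \<le> 0"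
      unfolding left_ineq_eq[OF r0, of "y r" "m r"] by simp
    then show ?thesis using zero_less_power[OF r0, of 4] by (auto simp: mult_le_0_iff)
  qed
qed

lemma near_right:
  assumes r: "1 / 2 \<le> r" "r \<le> 5 / 2"
  shows "0 < w_near 1 r" "defect (alp 1) (alp1 1) (alp2 1) bet bet1 bet2 r (y r) (m r) \<le> 0"
proof -
  have r0: "0 < r" using r by simp
  have W: "0 \<le> W_ineq r (r * y r) (m r) \<and> 0 < W_pos r (r * y r)"
  proof (cases "r \<le> 1")
    case True
    have "m r \<le> 6" using m_antimono[of "1 / 2" r] m_half r by simp
    then show ?thesis
      using mid_ineq[OF r(1) True less_imp_le[OF TR_less[OF r(1) True]] less_imp_le[OF X_less[OF r0]]] by simp
  next
    case False
    define d where "d = 1 + 1 / r - y r"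
    have e: "1 + r - r * d = r * y r" using r0 by (simp add: d_def field_simps)
    have "0 \<le> d" using y_less[OF r0] by (simp add: d_def)
    then show ?thesis
      using right_ineq[of r d "m r"] far_field(2)[of r] m_far[of r] r False by (simp add: e d_def[symmetric])
  qed
  have "0 < r\<^sup>2 * (alp 1 r + bet r * y r)" using W W_pos_eq[OF r0, of "y r"] by simp
  then have "0 < alp 1 r + bet r * y r" using r0 by (simp add: zero_less_mult_iff)
  then show "0 < w_near 1 r" using r0 Q_pos[of r] by (simp add: w_near_def comb_eq)
  show "defect (alp 1) (alp1 1) (alp2 1) bet bet1 bet2 r (y r) (m r) \<le> 0"
    using W W_ineq_eq[OF r0, of "y r" "m r"] r0 by (simp add: mult_le_0_iff)
qed

lemma w_far_pos:
  assumes "1 \<le> r" shows "0 < w_far r"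
proof -
  have "0 < 7 / (10 * r)" using assms by simp
  then have "1 < y r" using y_far[OF assms] by linarith
  then show ?thesis using assms Q_pos[of r] by (simp add: w_far_def comb_eq)
qed

lemma w_near_half: "w_near 1 (1 / 2) = w_near 0 (1 / 2)" "w_near' 1 (1 / 2) = w_near' 0 (1 / 2)"
  by (simp_all add: w_near_def w_near'_def comb_def comb1_def alp_half)

text \<open>The logarithmic derivative of the far supersolution does not exceed that of the near
  one, so a positive Wronskian survives the exchange.\<close>

lemma junction: "w_far' (5 / 2) * w_near 1 (5 / 2) \<le> w_near' 1 (5 / 2) * w_far (5 / 2)"
proof -
  define d where "d = 1 + 1 / (5 / 2) - y (5 / 2)"
  define \<mu> where "\<mu> = m (5 / 2)"
  have y: "y (5 / 2) = 7 / 5 - d" by (simp add: d_def)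
  have d0: "0 \<le> d" using y_less[of "5 / 2"] by (simp add: d_def)
  \<comment> \<open>107 divided by the value of \<open>M_poly\<close> at 5/2 is about
    0.0283.\<close>
  have \<mu>: "\<mu> \<le> 29 / 1000" using m_far[of "5 / 2"] by (simp add: \<mu>_def M_poly_def)
  have "d \<le> 1" using far_field(2)[of "5 / 2"] \<mu> by (simp add: d_def \<mu>_def)
  define e where "e = 5 / 2 * Q (5 / 2)"
  have nums: "alp 1 (5 / 2) = 229303 / 25" "alp1 1 (5 / 2) = 5791788 / 125"
    "bet (5 / 2) = 470703 / 10" "bet1 (5 / 2) = 186697 / 25"
    by (simp_all add: alp_def alp1_def bet_def bet1_def bet2_def D0_poly_def D1_poly_def power_numeral_reduce)
  have "w_near' 1 (5 / 2) * w_far (5 / 2) - w_far' (5 / 2) * w_near 1 (5 / 2)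
      = e\<^sup>2 * exp (5 / 2) * (1053941 / 625 - 2812121 / 50 * \<mu> + d * (36651753 / 250 - 2396121 / 25 * d))"
    unfolding w_near'_def w_far'_def w_near_def w_far_def
    by (simp add: comb_eq comb1_eq nums y \<mu>_def[symmetric] e_def power2_eq_square field_simps)
  moreover have "0 \<le> d * (36651753 / 250 - 2396121 / 25 * d)"
    using d0 \<open>d \<le> 1\<close> by (intro mult_nonneg_nonneg) auto
  then have "0 \<le> 1053941 / 625 - 2812121 / 50 * \<mu> + d * (36651753 / 250 - 2396121 / 25 * d)"
    using \<mu> by simp
  ultimately show ?thesis by (metis diff_ge_0_iff_ge exp_ge_zero mult_nonneg_nonneg zero_le_power2)
qed

text \<open>r^3 m is nonincreasing on r \<ge> 1 because r y \<ge> 3/2 there. Hence r^2 m is at most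
  1.07 / 2.5 for r \<ge> 5/2, well below 2/3.\<close>

lemma potential_nonneg:
  assumes r: "5 / 2 \<le> r" shows "0 \<le> 2 / r\<^sup>2 - 3 * m r"
proof -
  have "r ^ 3 * m r \<le> 1 ^ 3 * m 1"
  proof (rule DERIV_nonpos_imp_nonincreasing[where f = "\<lambda>r. r ^ 3 * m r"])
    fix x assume x: "1 \<le> x" "x \<le> r"
    have "x * (1 + 7 / (10 * x)) \<le> x * y x" using y_far[OF x(1)] x by (intro mult_left_mono) auto
    moreover have "x * (1 + 7 / (10 * x)) = x + 7 / 10" using x by (simp add: field_simps)
    ultimately have "3 / 2 \<le> x * y x" using x by simp
    then have "x\<^sup>2 * m x * (3 - 2 * (x * y x)) \<le> 0" using m_pos[of x] x by (intro mult_nonneg_nonpos) auto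
    moreover have "((\<lambda>r. r ^ 3 * m r) has_real_derivative x\<^sup>2 * m x * (3 - 2 * (x * y x))) (at x)"
      using x by (auto intro!: derivative_eq_intros m_deriv simp: power_numeral_reduce algebra_simps)
    ultimately show "\<exists>y. ((\<lambda>r. r ^ 3 * m r) has_real_derivative y) (at x) \<and> y \<le> 0" by blast
  qed (use r in simp)
  then have "r ^ 3 * m r \<le> 107 / 100" using m_one by simp
  moreover have "5 / 2 * (r\<^sup>2 * m r) \<le> r * (r\<^sup>2 * m r)"
    using r m_pos[of r] by (intro mult_right_mono) auto
  ultimately have "3 * (r\<^sup>2 * m r) \<le> 2" by (simp add: power_numeral_reduce algebra_simps)
  then show ?thesis using r by (simp add: field_simps)
qed

end

section \<open>The linearised equation\<close>

locale linear_solution = ground_state +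
  fixes G G' :: "real \<Rightarrow> real" and t0 :: real
  assumes t0: "1 / 5 \<le> t0" and G0: "G 0 = 0" and G'0: "G' 0 = 1"
    and G_deriv: "\<And>t. 0 \<le> t \<Longrightarrow> (G has_real_derivative G' t) (at t within {0..})"
    and G'_deriv: "\<And>t. 0 < t \<Longrightarrow>
      (G' has_real_derivative (2 / (t + t0)\<^sup>2 - 3 * (Q (t + t0))\<^sup>2) * G t) (at t)"
begin

definition H :: "real \<Rightarrow> real" where "H r = G (r - t0)"
definition H' :: "real \<Rightarrow> real" where "H' r = G' (r - t0)"

lemma G_deriv_at: "0 < t \<Longrightarrow> (G has_real_derivative G' t) (at t)"
  using G_deriv[of t] at_within_interior[of t "{0..}"] by simp

lemma shift_deriv: "((\<lambda>r. r - t0) has_real_derivative 1) (at r)"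
  by (auto intro!: derivative_eq_intros)

lemma H_deriv: "t0 < r \<Longrightarrow> (H has_real_derivative H' r) (at r)"
  unfolding H_def[abs_def] H'_def
  using DERIV_chain2[OF G_deriv_at shift_deriv, of r] by simp

lemma H'_deriv: "t0 < r \<Longrightarrow> (H' has_real_derivative (2 / r\<^sup>2 - 3 * m r) * H r) (at r)"
  unfolding H_def H'_def[abs_def] m_def
  using DERIV_chain2[OF G'_deriv shift_deriv, of r] by simp

text \<open>The derivative G' need not be continuous at 0 a priori, so the comparison starts at a point
  supplied by the mean value theorem.\<close>

lemma start:
  assumes w: "isCont w t0" "isCont w' t0" "0 < w t0" and e: "0 < e"
  obtains a where "t0 < a" "a < t0 + e" "\<And>r. t0 < r \<Longrightarrow> r \<le> a \<Longrightarrow> 0 < H r"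
    "0 < H' a * w a - H a * w' a"
proof -
  have G_lim: "(G \<longlongrightarrow> 0) (at_right 0)"
  proof -
    have "continuous (at 0 within {0..}) G" using G_deriv[of 0] by (intro DERIV_continuous) auto
    then have "(G \<longlongrightarrow> G 0) (at 0 within {0..})" by (simp add: continuous_within)
    then have "(G \<longlongrightarrow> G 0) (at_right 0)" by (rule tendsto_within_subset) auto
    then show ?thesis by (simp add: G0)
  qed
  have "((\<lambda>t. (G t - G 0) / (t - 0)) \<longlongrightarrow> G' 0) (at 0 within {0..})"
    using G_deriv[of 0] by (simp add: has_field_derivative_iff)
  then have "((\<lambda>t. (G t - G 0) / (t - 0)) \<longlongrightarrow> G' 0) (at_right 0)"
    by (rule tendsto_within_subset) auto
  then have "((\<lambda>t. G t / t) \<longlongrightarrow> 1) (at_right 0)" by (simp add: G0 G'0)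
  then have 1: "eventually (\<lambda>t. 1 / 2 < G t / t) (at_right 0)" by (rule order_tendstoD) simp
  have shift: "((\<lambda>t. f (t0 + t)) \<longlongrightarrow> f t0) (at_right 0)" if "isCont f t0" for f :: "real \<Rightarrow> real"
  proof -
    have "((\<lambda>t. t0 + t) \<longlongrightarrow> t0 + 0) (at_right 0)" by (intro tendsto_intros)
    then show ?thesis using that by (auto intro: isCont_tendsto_compose)
  qed
  have "eventually (\<lambda>t. w t0 / 2 < w (t0 + t)) (at_right 0)"
    by (rule order_tendstoD[OF shift[OF w(1)]]) (use w(3) in simp)
  moreover have "((\<lambda>t. G t * w' (t0 + t)) \<longlongrightarrow> 0 * w' t0) (at_right 0)"
    by (intro tendsto_intros G_lim shift w)
  then have "eventually (\<lambda>t. G t * w' (t0 + t) < w t0 / 4) (at_right 0)"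
    by (rule order_tendstoD) (use w(3) in simp)
  ultimately have "eventually (\<lambda>t. 1 / 2 < G t / t \<and> w t0 / 2 < w (t0 + t) \<and>
      G t * w' (t0 + t) < w t0 / 4) (at_right 0)"
    using 1 by eventually_elim simp
  then obtain h where h: "0 < h" "\<And>t. 0 < t \<Longrightarrow> t < h \<Longrightarrow> 1 / 2 < G t / t \<and> w t0 / 2 < w (t0 + t) \<and>
      G t * w' (t0 + t) < w t0 / 4"
    by (auto simp: eventually_at_right_field)
  define t where "t = min h e / 2"
  have t: "0 < t" "t < h" "t < e" using h e by (auto simp: t_def)
  have "\<exists>l z. 0 < z \<and> z < t \<and> DERIV G z :> l \<and> G t - G 0 = (t - 0) * l"
  proof (rule MVT)
    show "continuous_on {0..t} G"
      by (intro DERIV_continuous_on[OF DERIV_subset[OF G_deriv]]) auto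
    show "G differentiable (at x)" if "0 < x" "x < t" for x
      using G_deriv_at[OF that(1)] by (auto simp: real_differentiable_def)
  qed (use t in auto)
  then obtain z where z: "0 < z" "z < t" "G t = t * G' z"
    using DERIV_unique[OF G_deriv_at] by (force simp: G0)
  have "1 / 2 < G' z" using h(2)[OF t(1,2)] t z(3) by simp
  moreover have hz: "w t0 / 2 < w (t0 + z)" "G z * w' (t0 + z) < w t0 / 4" using h(2)[of z] z t by auto
  \<comment> \<open>Both halves of the Wronskian are compared with w(t0) / 4: G' w lies above it and
    G w' below.\<close>
  ultimately have "1 / 2 * (w t0 / 2) < G' z * w (t0 + z)" using w(3) by (intro mult_strict_mono) auto
  then have "0 < H' (t0 + z) * w (t0 + z) - H (t0 + z) * w' (t0 + z)" using hz by (simp add: H_def H'_def)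
  moreover have "0 < H r" if "t0 < r" "r \<le> t0 + z" for r
  proof -
    have "1 / 2 < G (r - t0) / (r - t0)" using h(2)[of "r - t0"] that z t by simp
    then have "0 < G (r - t0) / (r - t0)" by linarith
    then show ?thesis using that by (simp add: H_def zero_less_divide_iff)
  qed
  ultimately show ?thesis using that[of "t0 + z"] z t by auto
qed

lemma near_compare:
  assumes ab: "t0 < a" "a \<le> b"
    and pos: "\<And>r. a \<le> r \<Longrightarrow> r \<le> b \<Longrightarrow> 0 < w_near \<delta> r"
    and defect: "\<And>r. a \<le> r \<Longrightarrow> r \<le> b \<Longrightarrow>
      defect (alp \<delta>) (alp1 \<delta>) (alp2 \<delta>) bet bet1 bet2 r (y r) (m r) \<le> 0"
    and init: "0 < H a" "0 < H' a * w_near \<delta> a - H a * w_near' \<delta> a"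
  shows "0 < H b" "0 < H' b * w_near \<delta> b - H b * w_near' \<delta> b"
proof -
  let ?w'' = "\<lambda>r. (2 / r\<^sup>2 - 3 * m r) * w_near \<delta> r
    + r * Q r * defect (alp \<delta>) (alp1 \<delta>) (alp2 \<delta>) bet bet1 bet2 r (y r) (m r)"
  have r0: "0 < r" if "a \<le> r" for r using that ab t0 by simp
  have "?w'' r \<le> (2 / r\<^sup>2 - 3 * m r) * w_near \<delta> r" if "a \<le> r" "r \<le> b" for r
    using defect[OF that] Q_pos[of r] r0[OF that(1)] by (simp add: mult_nonneg_nonpos)
  note sturm = sturm_comparison[where H = H and H' = H' and w = "w_near \<delta>" and w' = "w_near' \<delta>" and w'' = ?w''
      and V = "\<lambda>r. 2 / r\<^sup>2 - 3 * m r", OF ab(2) _ _ _ _ pos this init]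
  show "0 < H b" using ab r0 by (intro sturm(1) H_deriv H'_deriv w_near_deriv) auto
  have "H' a * w_near \<delta> a - H a * w_near' \<delta> a \<le> H' b * w_near \<delta> b - H b * w_near' \<delta> b"
    using ab r0 by (intro sturm(2) H_deriv H'_deriv w_near_deriv) auto
  then show "0 < H' b * w_near \<delta> b - H b * w_near' \<delta> b" using init(2) by simp
qed

lemma far_compare:
  assumes ab: "t0 < a" "5 / 2 \<le> a" "a \<le> b"
    and init: "0 < H a" "0 < H' a * w_far a - H a * w_far' a"
  shows "0 < H b" "H' a * w_far a - H a * w_far' a \<le> H' b * w_far b - H b * w_far' b"
proof -
  let ?w'' = "\<lambda>r. (2 / r\<^sup>2 - 3 * m r) * w_far r + r * Q r * (- exp r * (4 - 2 / r) * (1 + 1 / r - y r))"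
  have pos: "0 < w_far r" if "a \<le> r" "r \<le> b" for r using that ab by (intro w_far_pos) simp
  have "?w'' r \<le> (2 / r\<^sup>2 - 3 * m r) * w_far r" if "a \<le> r" "r \<le> b" for r
  proof -
    have "0 \<le> exp r * (4 - 2 / r) * (1 + 1 / r - y r)"
      using that ab y_less[of r] by (intro mult_nonneg_nonneg) (auto simp: field_simps)
    then show ?thesis using Q_pos[of r] that ab by (simp add: mult_nonneg_nonneg mult.assoc)
  qed
  note sturm = sturm_comparison[where H = H and H' = H' and w = w_far and w' = w_far' and w'' = ?w''
      and V = "\<lambda>r. 2 / r\<^sup>2 - 3 * m r", OF ab(3) _ _ _ _ pos this init]
  show "0 < H b" using ab by (intro sturm(1) H_deriv H'_deriv w_far_deriv) auto
  show "H' a * w_far a - H a * w_far' a \<le> H' b * w_far b - H b * w_far' b"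
    using ab by (intro sturm(2) H_deriv H'_deriv w_far_deriv) auto
qed

lemma right_phase:
  assumes a: "t0 < a" "1 / 2 \<le> a" "a \<le> b" "b \<le> 5 / 2"
    and init: "0 < H a" "0 < H' a * w_near 1 a - H a * w_near' 1 a"
  shows "0 < H b" "0 < H' b * w_near 1 b - H b * w_near' 1 b"
  using near_compare[OF a(1,3) _ _ init] near_right a by auto

lemma left_phase:
  assumes a: "t0 < a" "a \<le> b" "b \<le> 1 / 2"
    and init: "0 < H a" "0 < H' a * w_near 0 a - H a * w_near' 0 a"
  shows "0 < H b" "0 < H' b * w_near 0 b - H b * w_near' 0 b"
  using near_compare[OF a(1,2) _ _ init] near_left a t0 by auto

text \<open>The far Wronskian times \<open>w_near\<close> is the near Wronskian times
  \<open>w_far\<close> plus H times the difference in \<open>junction\<close>.\<close>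

lemma far_start:
  assumes "0 < H (5 / 2)" "0 < H' (5 / 2) * w_near 1 (5 / 2) - H (5 / 2) * w_near' 1 (5 / 2)"
  shows "0 < H' (5 / 2) * w_far (5 / 2) - H (5 / 2) * w_far' (5 / 2)"
proof -
  let ?r = "5 / 2 :: real"
  have pos: "0 < w_near 1 ?r" "0 < w_far ?r" by (auto intro: near_right w_far_pos)
  have "H ?r * (w_far' ?r * w_near 1 ?r) \<le> H ?r * (w_near' 1 ?r * w_far ?r)"
    using junction assms(1) by (intro mult_left_mono) auto
  moreover have "0 < (H' ?r * w_near 1 ?r - H ?r * w_near' 1 ?r) * w_far ?r"
    using assms(2) pos by simp
  ultimately have "0 < w_near 1 ?r * (H' ?r * w_far ?r - H ?r * w_far' ?r)"
    by (simp add: algebra_simps)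
  then show ?thesis using pos by (simp add: zero_less_mult_iff)
qed

lemma reach_far:
  obtains a where "t0 < a" "5 / 2 \<le> a" "\<And>r. t0 < r \<Longrightarrow> r \<le> a \<Longrightarrow> 0 < H r"
    "0 < H' a * w_far a - H a * w_far' a"
proof -
  have t00: "0 < t0" using t0 by simp
  have near_cont: "isCont (w_near \<delta>) t0" "isCont (w_near' \<delta>) t0" for \<delta>
    using w_near_deriv[OF t00] by (auto intro: DERIV_isCont)
  consider "t0 < 1 / 2" | "1 / 2 \<le> t0" "t0 < 5 / 2" | "5 / 2 \<le> t0" by linarith
  then show ?thesis
  proof cases
    case 1
    obtain a where a: "t0 < a" "a < t0 + (1 / 2 - t0)" "\<And>r. t0 < r \<Longrightarrow> r \<le> a \<Longrightarrow> 0 < H r"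
        "0 < H' a * w_near 0 a - H a * w_near' 0 a"
      by (rule start[of "w_near 0" "w_near' 0" "1 / 2 - t0"]) (use 1 near_cont near_left(1)[of t0] t0 in auto)
    have Ha: "0 < H a" using a by simp
    have half: "0 < H (1 / 2)" "0 < H' (1 / 2) * w_near 1 (1 / 2) - H (1 / 2) * w_near' 1 (1 / 2)"
      using left_phase[OF a(1) _ _ Ha a(4), of "1 / 2"] a by (auto simp: w_near_half)
    have pos: "0 < H r" if "t0 < r" "r \<le> 5 / 2" for r
    proof -
      consider "r \<le> a" | "a < r" "r \<le> 1 / 2" | "1 / 2 < r" by linarith
      then show ?thesis
        using a(3) left_phase(1)[OF a(1) _ _ Ha a(4)] right_phase(1)[OF _ _ _ _ half] that 1 by cases auto
    qed
    have "0 < H' (5 / 2) * w_near 1 (5 / 2) - H (5 / 2) * w_near' 1 (5 / 2)"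
      using right_phase(2)[OF _ _ _ _ half, of "5 / 2"] 1 by simp
    then show ?thesis using that[of "5 / 2"] pos far_start 1 by auto
  next
    case 2
    obtain a where a: "t0 < a" "a < t0 + (5 / 2 - t0)" "\<And>r. t0 < r \<Longrightarrow> r \<le> a \<Longrightarrow> 0 < H r"
        "0 < H' a * w_near 1 a - H a * w_near' 1 a"
      by (rule start[of "w_near 1" "w_near' 1" "5 / 2 - t0"]) (use 2 near_cont near_right(1)[of t0] in auto)
    have Ha: "0 < H a" using a by simp
    have pos: "0 < H r" if "t0 < r" "r \<le> 5 / 2" for r
      using a(3)[of r] right_phase(1)[OF a(1) _ _ _ Ha a(4), of r] that 2 a by (cases "r \<le> a") auto
    have "0 < H' (5 / 2) * w_near 1 (5 / 2) - H (5 / 2) * w_near' 1 (5 / 2)"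
      using right_phase(2)[OF a(1) _ _ _ Ha a(4), of "5 / 2"] 2 a by simp
    then show ?thesis using that[of "5 / 2"] pos far_start 2 by auto
  next
    case 3
    have "isCont w_far t0" "isCont w_far' t0"
      using w_far_deriv[OF t00] by (auto intro: DERIV_isCont)
    then obtain a where "t0 < a" "a < t0 + 1" "\<And>r. t0 < r \<Longrightarrow> r \<le> a \<Longrightarrow> 0 < H r"
        "0 < H' a * w_far a - H a * w_far' a"
      by (rule start[of w_far w_far' 1]) (use 3 w_far_pos[of t0] in auto)
    then show ?thesis using that[of a] 3 by auto
  qed
qed

text \<open>If H' never became positive, H would stay bounded and the Wronskian bound would force
  w_far' \<le> -\<epsilon>, contradicting the positivity of w_far.\<close>

lemma H_growth:
  shows "t0 < r \<Longrightarrow> 0 < H r"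
    and "\<exists>r1>t0. \<exists>s>0. \<forall>r\<ge>r1. s * (r - r1) \<le> H r"
proof -
  obtain a where a: "t0 < a" "5 / 2 \<le> a" "\<And>r. t0 < r \<Longrightarrow> r \<le> a \<Longrightarrow> 0 < H r"
      "0 < H' a * w_far a - H a * w_far' a"
    using reach_far by blast
  have Ha: "0 < H a" using a by simp
  have pos: "0 < H r" if "t0 < r" for r
    using a(3)[OF that] far_compare(1)[OF a(1,2) _ Ha a(4), of r] by (cases "r \<le> a") auto
  then show "t0 < r \<Longrightarrow> 0 < H r" by blast
  have H'_mono: "H' r \<le> H' s" if "a \<le> r" "r \<le> s" for r s
    using that(2)
  proof (rule DERIV_nonneg_imp_nondecreasing)
    fix x assume x: "r \<le> x" "x \<le> s"
    have "0 \<le> (2 / x\<^sup>2 - 3 * m x) * H x"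
      using potential_nonneg[of x] pos[of x] x that a by (intro mult_nonneg_nonneg) auto
    then show "\<exists>y. (H' has_real_derivative y) (at x) \<and> 0 \<le> y"
      using H'_deriv[of x] x that a by auto
  qed
  have "\<exists>r1\<ge>a. 0 < H' r1"
  proof (rule ccontr)
    assume "\<not> (\<exists>r1\<ge>a. 0 < H' r1)"
    then have neg: "H' r \<le> 0" if "a \<le> r" for r using that by force
    define \<epsilon> where "\<epsilon> = (H' a * w_far a - H a * w_far' a) / H a"
    have \<epsilon>: "0 < \<epsilon>" using a(4) Ha by (simp add: \<epsilon>_def)
    have w': "w_far' r \<le> - \<epsilon>" if r: "a \<le> r" for r
    proof -
      have Hr: "0 < H r" "H r \<le> H a"
      proof -
        show "0 < H r" using pos[of r] r a by simp
        show "H r \<le> H a"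
          using r
        proof (rule DERIV_nonpos_imp_nonincreasing)
          fix x assume "a \<le> x" "x \<le> r"
          then show "\<exists>y. (H has_real_derivative y) (at x) \<and> y \<le> 0"
            using H_deriv[of x] neg[of x] a by auto
        qed
      qed
      have "\<epsilon> * H r \<le> \<epsilon> * H a" using Hr \<epsilon> by simp
      also have "\<dots> = H' a * w_far a - H a * w_far' a" using Ha by (simp add: \<epsilon>_def)
      also have "\<dots> \<le> H' r * w_far r - H r * w_far' r" by (rule far_compare(2)[OF a(1,2) r Ha a(4)])
      also have "\<dots> \<le> - H r * w_far' r"
        using neg[OF r] w_far_pos[of r] r a by (simp add: mult_nonpos_nonneg)
      finally have "H r * \<epsilon> \<le> H r * (- w_far' r)" by (simp add: mult.commute)
      then have "\<epsilon> \<le> - w_far' r" using Hr(1) by (simp only: mult_le_cancel_left_pos)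
      then show ?thesis by simp
    qed
    \<comment> \<open>The point at which the line of slope -\<epsilon> through the value of
      \<open>w_far\<close> at a reaches 0.\<close>
    define r where "r = a + w_far a / \<epsilon>"
    have ar: "a \<le> r" using \<epsilon> w_far_pos[of a] a by (simp add: r_def)
    have "w_far r + \<epsilon> * r \<le> w_far a + \<epsilon> * a"
      using ar
    proof (rule DERIV_nonpos_imp_nonincreasing[where f = "\<lambda>r. w_far r + \<epsilon> * r"])
      fix x assume x: "a \<le> x" "x \<le> r"
      have "((\<lambda>r. w_far r + \<epsilon> * r) has_real_derivative w_far' x + \<epsilon>) (at x)"
        using x a by (auto intro!: derivative_eq_intros w_far_deriv)
      then show "\<exists>y. ((\<lambda>r. w_far r + \<epsilon> * r) has_real_derivative y) (at x) \<and> y \<le> 0"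
        using w'[OF x(1)] by (intro exI[of _ "w_far' x + \<epsilon>"]) simp
    qed
    moreover have "\<epsilon> * r = \<epsilon> * a + w_far a" using \<epsilon> by (simp add: r_def field_simps)
    ultimately have "w_far r \<le> 0" by simp
    then show False using w_far_pos[of r] ar a by simp
  qed
  then obtain r1 where r1: "a \<le> r1" "0 < H' r1" by blast
  have "H' r1 * (r - r1) \<le> H r" if r: "r1 \<le> r" for r
  proof -
    have "H r1 - H' r1 * r1 \<le> H r - H' r1 * r"
      using r
    proof (rule DERIV_nonneg_imp_nondecreasing[where f = "\<lambda>r. H r - H' r1 * r"])
      fix x assume x: "r1 \<le> x" "x \<le> r"
      have "((\<lambda>r. H r - H' r1 * r) has_real_derivative H' x - H' r1) (at x)"
        using x a r1 by (auto intro!: derivative_eq_intros H_deriv)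
      then show "\<exists>y. ((\<lambda>r. H r - H' r1 * r) has_real_derivative y) (at x) \<and> 0 \<le> y"
        using H'_mono[OF r1(1) x(1)] by (intro exI[of _ "H' x - H' r1"]) simp
    qed
    then show ?thesis using pos[of r1] r1 a by (simp add: algebra_simps)
  qed
  then show "\<exists>r1>t0. \<exists>s>0. \<forall>r\<ge>r1. s * (r - r1) \<le> H r" using r1 a by (intro exI[of _ r1]) auto
qed

lemma G_pos: "0 < t \<Longrightarrow> 0 < G t"
  using H_growth(1)[of "t + t0"] by (simp add: H_def)

lemma G_growth: "\<exists>c>0. \<exists>c2>0. \<forall>t\<ge>5/2. G t > c * t powr c2"
proof -
  obtain r1 s where s: "t0 < r1" "0 < s" "\<And>r. r1 \<le> r \<Longrightarrow> s * (r - r1) \<le> H r"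
    using H_growth(2) by blast
  define \<tau> where "\<tau> = r1 - t0"
  have lin: "s * (t - \<tau>) \<le> G t" if "\<tau> \<le> t" for t
    using s(3)[of "t + t0"] that by (simp add: \<tau>_def H_def algebra_simps)
  \<comment> \<open>Beyond 2 \<tau> one has t - \<tau> \<ge> t / 2, so the linear bound is
    effective; on the compact rest a positive minimum of G suffices. The exponent is 1.\<close>
  define T where "T = max (5 / 2) (2 * \<tau>)"
  have "continuous_on {5 / 2..T} G"
    by (intro DERIV_continuous_on[OF DERIV_subset[OF G_deriv_at]]) auto
  then obtain x where x: "x \<in> {5 / 2..T}" "\<And>t. t \<in> {5 / 2..T} \<Longrightarrow> G x \<le> G t"
    using continuous_attains_inf[of "{5 / 2..T}" G] by (auto simp: T_def)
  have Gx: "0 < G x" using x(1) by (intro G_pos) auto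
  have T: "0 < T" by (simp add: T_def)
  define c where "c = min (s / 4) (G x / (2 * T))"
  have c: "0 < c" using s Gx T by (simp add: c_def)
  have "c * t < G t" if t: "5 / 2 \<le> t" for t
  proof (cases "t \<le> T")
    case True
    have "c * t \<le> G x / (2 * T) * T" using True t Gx T by (intro mult_mono) (auto simp: c_def)
    also have "\<dots> < G x" using Gx T by simp
    also have "\<dots> \<le> G t" using True t by (intro x) auto
    finally show ?thesis .
  next
    case False
    have "c * t \<le> s / 4 * t" using t by (intro mult_right_mono) (auto simp: c_def)
    also have "\<dots> < s * (t / 2)" using s t by simp
    also have "\<dots> \<le> s * (t - \<tau>)" using s False by (intro mult_left_mono) (auto simp: T_def)
    also have "\<dots> \<le> G t" using False t s by (intro lin) (auto simp: T_def \<tau>_def)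
    finally show ?thesis .
  qed
  then show ?thesis using c by (intro exI[of _ c] conjI exI[of _ 1]) auto
qed

end

theorem proposition4p1:
  fixes Q G G' :: "real \<Rightarrow> real" and t0 :: real
  assumes hQ: "ground_state_profile Q"
    and ht0: "t0 \<ge> 1 / 5"
    and hG0: "G 0 = 0"
    and hG'0: "G' 0 = 1"
    and hGd: "\<forall>t\<ge>0. (G has_real_derivative G' t) (at t within {0..})"
    and hGdd: "\<forall>t>0. (G' has_real_derivative
                 ((2 / (t + t0)^2 - 3 * Q (t + t0) ^ 2) * G t)) (at t)"
  shows "(\<forall>t>0. G t > 0) \<and>
         (\<exists>c>0. \<exists>c2>0. \<forall>t\<ge>5/2. G t > c * t powr c2)"
proof -
  obtain P where "\<forall>t>0. (Q has_real_derivative P t) (at t)"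
    "\<forall>t>0. (P has_real_derivative (Q t - Q t ^ 3 - (2 / t) * P t)) (at t)" "(P \<longlongrightarrow> 0) (at_right 0)"
    using hQ unfolding ground_state_profile_def by blast
  with hQ interpret linear_solution Q P G G' t0
    by unfold_locales (use ht0 hG0 hG'0 hGd hGdd in \<open>auto simp: ground_state_profile_def\<close>)
  show ?thesis using G_pos G_growth by blast
qed

end
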